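(* Let $\alpha\in\mathbb{R}$ be not a rational multiple of $\pi$, and let $u_m=(\cos m\alpha,\sin m\alpha)\in S^1$ for $m\ge 1$. Let $K\subset\mathbb{R}^2$ be a non-empty compact set. Then the symmetrals $\mathcal{S}_{u_m}\cdots\mathcal{S}_{u_1}K$ converge, as $m\to\infty$, in Hausdorff distance and in symmetric difference to $K^*$, the closed ball centered at the origin with the same Lebesgue measure as $K$.
   Context: $S^1$ is the unit circle in $\mathbb{R}^2$ and $\lambda_2$ is Lebesgue measure on $\mathbb{R}^2$. If $\lambda_2(K)=0$, then $K^*$ is the degenerate ball $\{o\}$ consisting of the origin. For $\delta>0$, $K_{(\delta)}=K+B_\delta$ denotes the outer parallel set, where $B_\delta$ is the closed ball of radius $\delta$ centered at the origin; the Hausdorff distance of compact sets $K,L$ is $d_H(K,L)=\inf\{\delta>0: K\subset L_{(\delta)}\text{ and }L\subset K_{(\delta)}\}$. A sequence of compact sets $(K_m)$ converges in symmetric difference to a compact set $L$ if $\lim_{m\to\infty}\lambda_2(K_m\bigtriangleup L)=0$. Steiner symmetral: for $u\in S^1$ and $K\subset\mathbb{R}^2$ compact, $\mathcal{S}_uK$ is the compact set defined as follows. Let $u^\perp$ be the line through the origin orthogonal to $u$ and, for $y\in u^\perp$, let $\ell_y=y+\mathbb{R}u$. If $\ell_y\cap K\ne\emptyset$, then $\ell_y\cap\mathcal{S}_uK$ is the closed line segment in $\ell_y$ centered at $y$ whose length is the one-dimensional Lebesgue measure of $\ell_y\cap K$ (the single point $\{y\}$ if this measure is zero); if $\ell_y\cap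 K=\emptyset$, then $\ell_y\cap\mathcal{S}_uK=\emptyset$. *)

theory Defs
  imports "HOL-Analysis.Analysis"
begin

definition outer_parallel :: "('a::real_normed_vector) set \<Rightarrow> real \<Rightarrow> 'a set" where
  "outer_parallel K \<delta> = {x + b |x b. x \<in> K \<and> b \<in> cball 0 \<delta>}"

text \<open>Meant for non-empty compact sets only, for which the set of admissible radii is non-empty.\<close>

definition hausdorff_distance :: "('a::real_normed_vector) set \<Rightarrow> 'a set \<Rightarrow> real" where
  "hausdorff_distance K L =
     Inf {\<delta>. 0 < \<delta> \<and> K \<subseteq> outer_parallel L \<delta> \<and> L \<subseteq> outer_parallel K \<delta>}"

definition line_through :: "real^2 \<Rightarrow> real^2 \<Rightarrow> (real^2) set" where
  "line_through y u = range (\<lambda>t. y + t *\<^sub>R u)"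

text \<open>The one-dimensional Lebesgue measure of \<open>K\<close> intersected with the line through \<open>y\<close> in
  direction \<open>u\<close>; the parametrisation by \<open>t\<close> is an isometry because \<open>u\<close> will be a unit vector.\<close>

definition chord_length :: "real^2 \<Rightarrow> (real^2) set \<Rightarrow> real^2 \<Rightarrow> real" where
  "chord_length u K y = measure lebesgue {t. y + t *\<^sub>R u \<in> K}"

definition steiner_symmetral :: "real^2 \<Rightarrow> (real^2) set \<Rightarrow> (real^2) set" where
  "steiner_symmetral u K =
     (\<Union>y \<in> {y. orthogonal u y \<and> line_through y u \<inter> K \<noteq> {}}.
        closed_segment (y - (chord_length u K y / 2) *\<^sub>R u) (y + (chord_length u K y / 2) *\<^sub>R u))"

text \<open>\<open>successive_symmetrals u K m\<close> is \<open>K\<close> symmetrized first along \<open>u 1\<close>, then along \<open>u 2\<close>,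
  and so on up to \<open>u m\<close>; the value \<open>u 0\<close> is not used.\<close>

primrec successive_symmetrals :: "(nat \<Rightarrow> real^2) \<Rightarrow> (real^2) set \<Rightarrow> nat \<Rightarrow> (real^2) set" where
  "successive_symmetrals u K 0 = K"
| "successive_symmetrals u K (Suc m) = steiner_symmetral (u (Suc m)) (successive_symmetrals u K m)"

text \<open>If \<open>K\<close> is a null set, the radius is \<open>0\<close> and the ball is the singleton of the origin.\<close>

definition equimeasurable_ball :: "(real^2) set \<Rightarrow> (real^2) set" where
  "equimeasurable_ball K =
     cball 0 (THE r. 0 \<le> r \<and> measure lebesgue (cball (0::real^2) r) = measure lebesgue K)"

lemma equimeasurable_ball_radius:
  "\<exists>!r. 0 \<le> r \<and> measure lebesgue (cball (0::real^2) r) = measure lebesgue K"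
proof -
  have eq: "measure lebesgue (cball (0::real^2) r) = pi * r\<^sup>2" if "0 \<le> r" for r
    using content_cball[OF that, of "0::real^2"] by (simp add: unit_ball_vol_2 measure_completion)
  have "\<exists>!r. 0 \<le> r \<and> pi * r\<^sup>2 = measure lebesgue K"
  proof (rule ex1I[of _ "sqrt (measure lebesgue K / pi)"])
    show "0 \<le> sqrt (measure lebesgue K / pi) \<and>
        pi * (sqrt (measure lebesgue K / pi))\<^sup>2 = measure lebesgue K"
      by simp
  next
    fix r assume r: "0 \<le> r \<and> pi * r\<^sup>2 = measure lebesgue K"
    then have "measure lebesgue K / pi = r\<^sup>2" by (simp add: field_simps)
    then show "r = sqrt (measure lebesgue K / pi)" using r by simp
  qed
  then show ?thesis
    by (metis (no_types, lifting) eq)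
qed

definition converges_hausdorff :: "(nat \<Rightarrow> (real^2) set) \<Rightarrow> (real^2) set \<Rightarrow> bool" where
  "converges_hausdorff K L \<longleftrightarrow> (\<lambda>m. hausdorff_distance (K m) L) \<longlonglongrightarrow> 0"

definition converges_symmetric_difference :: "(nat \<Rightarrow> (real^2) set) \<Rightarrow> (real^2) set \<Rightarrow> bool" where
  "converges_symmetric_difference K L \<longleftrightarrow> (\<lambda>m. measure lebesgue (sym_diff (K m) L)) \<longlonglongrightarrow> 0"

end

theory Submission
  imports Defs "HOL-Complex_Analysis.Great_Picard"
begin

text \<open>In a frame rotating with the direction of symmetrization, the symmetrals form the orbit of the
  single map \<open>T A = S (\<rho> A)\<close>, with \<open>S\<close> the symmetrization along a fixed axis and \<open>\<rho>\<close> the rotation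
  by \<open>- \<alpha>\<close>. Since \<open>S\<close> is not continuous in Hausdorff distance, the Lyapunov functionals are taken to
  be the areas of \<open>A\<^sub>\<delta> - B\<^sub>r\<close>, where \<open>A\<^sub>\<delta>\<close> is the outer parallel set and \<open>B\<^sub>r\<close> a centered ball: they
  do not increase under \<open>T\<close>, because \<open>(S A)\<^sub>\<delta> \<subseteq> S (A\<^sub>\<delta>)\<close>, and they are monotone in \<open>A\<close> and
  continuous from the right in \<open>\<delta>\<close>, so that they agree on all Hausdorff limit points of the orbit. If
  \<open>L\<close> is a limit point and \<open>P = \<rho> L\<close>, then \<open>S P\<close> contains a limit point \<open>M\<close>. Equality of the
  functionals, for all \<open>r\<close>, forces \<open>S (P\<^sub>\<delta>) = P\<^sub>\<delta> = M\<^sub>\<delta>\<close> up to null sets, hence \<open>S P = P = M\<close>. So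
  all the \<open>\<rho>\<^sup>n L\<close> with \<open>n \<ge> 1\<close> are symmetric under the same reflection, which makes \<open>L\<close> invariant under
  the rotation by \<open>2 \<alpha>\<close>, hence under all rotations by irrationality. A rotation invariant set fixed by
  \<open>S\<close> is a ball, and its area is that of \<open>K\<close>. Blaschke's selection theorem then gives convergence
  of the whole orbit.\<close>

section \<open>Rotations and outer parallel sets\<close>

definition rot :: "real \<Rightarrow> real^2 \<Rightarrow> real^2" where
  "rot \<theta> x = vector [cos \<theta> * x$1 - sin \<theta> * x$2, sin \<theta> * x$1 + cos \<theta> * x$2]"

lemma rot_component [simp]:
  "rot \<theta> x $ 1 = cos \<theta> * x$1 - sin \<theta> * x$2"
  "rot \<theta> x $ 2 = sin \<theta> * x$1 + cos \<theta> * x$2"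
  by (simp_all add: rot_def)

lemma vec2_eq_iff: "x = y \<longleftrightarrow> x$1 = y$1 \<and> x$2 = y$2" for x y :: "real^2"
  by (simp add: vec_eq_iff forall_2)

lemma norm_vec2: "norm x = sqrt ((x$1)\<^sup>2 + (x$2)\<^sup>2)" for x :: "real^2"
  by (simp add: norm_eq_sqrt_inner inner_vec_def sum_2 power2_eq_square)

lemma dist_vec2: "dist x y = sqrt ((x$1 - y$1)\<^sup>2 + (x$2 - y$2)\<^sup>2)" for x y :: "real^2"
  by (simp add: dist_norm norm_vec2)

lemma rot_add: "rot (a + b) x = rot a (rot b x)"
  by (simp add: vec2_eq_iff cos_add sin_add algebra_simps)

lemma rot_0 [simp]: "rot 0 x = x"
  by (simp add: vec2_eq_iff)

lemma rot_minus_cancel [simp]: "rot (- a) (rot a x) = x" "rot a (rot (- a) x) = x"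
  by (simp_all flip: rot_add)

lemma rot_image_add: "rot (a + b) ` A = rot a ` rot b ` A"
  by (simp add: image_image rot_add)

lemma orthogonal_transformation_rot: "orthogonal_transformation (rot \<theta>)"
proof -
  have "linear (rot \<theta>)"
    by (rule linearI) (simp_all add: vec2_eq_iff algebra_simps)
  moreover have "norm (rot \<theta> x) = norm x" for x
  proof -
    have "(cos \<theta> * x$1 - sin \<theta> * x$2)\<^sup>2 + (sin \<theta> * x$1 + cos \<theta> * x$2)\<^sup>2
      = ((cos \<theta>)\<^sup>2 + (sin \<theta>)\<^sup>2) * ((x$1)\<^sup>2 + (x$2)\<^sup>2)"
      by (simp only: power2_eq_square) (simp only: algebra_simps)
    then show ?thesis by (simp add: norm_vec2)
  qed
  ultimately show ?thesis
    by (simp add: orthogonal_transformation)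
qed

lemmas linear_rot = orthogonal_transformation_linear[OF orthogonal_transformation_rot]

lemma norm_rot [simp]: "norm (rot \<theta> x) = norm x"
  using orthogonal_transformation_rot orthogonal_transformation_norm by blast

lemma dist_rot [simp]: "dist (rot \<theta> x) (rot \<theta> y) = dist x y"
  using linear_diff[OF linear_rot] by (metis dist_norm norm_rot)

lemma inj_rot: "inj (rot \<theta>)"
  by (metis injI rot_minus_cancel(1))

lemma compact_rot_image: "compact A \<Longrightarrow> compact (rot \<theta> ` A)"
  by (intro compact_continuous_image linear_continuous_on linear_rot)
    (simp add: linear_conv_bounded_linear linear_rot flip: linear_conv_bounded_linear)

lemma rot_image_cball [simp]: "rot \<theta> ` cball 0 r = cball 0 r"
proof (intro equalityI subsetI)
  fix x :: "real^2" assume "x \<in> cball 0 r"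
  then have "rot \<theta> (rot (- \<theta>) x) \<in> rot \<theta> ` cball 0 r"
    by (intro imageI) simp
  then show "x \<in> rot \<theta> ` cball 0 r" by simp
qed auto

lemma rot_image_ball [simp]: "rot \<theta> ` ball 0 r = ball 0 r"
proof (intro equalityI subsetI)
  fix x :: "real^2" assume "x \<in> ball 0 r"
  then have "rot \<theta> (rot (- \<theta>) x) \<in> rot \<theta> ` ball 0 r"
    by (intro imageI) simp
  then show "x \<in> rot \<theta> ` ball 0 r" by simp
qed auto

lemma measure_rot_image:
  "compact A \<Longrightarrow> measure lebesgue (rot \<theta> ` A) = measure lebesgue A"
  by (simp add: measure_orthogonal_image orthogonal_transformation_rot lmeasurable_compact)

section \<open>Outer parallel sets as closed distance neighbourhoods\<close>

lemma mem_outer_parallel: "x \<in> outer_parallel A \<delta> \<longleftrightarrow> (\<exists>a\<in>A. dist a x \<le> \<delta>)"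
proof
  assume "x \<in> outer_parallel A \<delta>"
  then show "\<exists>a\<in>A. dist a x \<le> \<delta>"
    by (force simp: outer_parallel_def dist_norm)
next
  assume "\<exists>a\<in>A. dist a x \<le> \<delta>"
  then obtain a where "a \<in> A" "dist a x \<le> \<delta>" by blast
  then have "x = a + (x - a)" "a \<in> A" "x - a \<in> cball 0 \<delta>"
    by (simp_all add: dist_norm norm_minus_commute)
  then show "x \<in> outer_parallel A \<delta>"
    unfolding outer_parallel_def by blast
qed

lemma outer_parallel_mono: "A \<subseteq> B \<Longrightarrow> \<delta> \<le> \<epsilon> \<Longrightarrow> outer_parallel A \<delta> \<subseteq> outer_parallel B \<epsilon>"
  unfolding subset_iff mem_outer_parallel by (meson order_trans)

lemma subset_outer_parallel: "0 \<le> \<delta> \<Longrightarrow> A \<subseteq> outer_parallel A \<delta>"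
  by (force simp: mem_outer_parallel)

lemma outer_parallel_0 [simp]: "outer_parallel A 0 = A"
  by (auto simp: mem_outer_parallel)

lemma outer_parallel_twice:
  "outer_parallel (outer_parallel A \<delta>) \<epsilon> \<subseteq> outer_parallel A (\<delta> + \<epsilon>)"
proof
  fix x assume "x \<in> outer_parallel (outer_parallel A \<delta>) \<epsilon>"
  then obtain a b where "a \<in> A" "dist a b \<le> \<delta>" "dist b x \<le> \<epsilon>"
    by (auto simp: mem_outer_parallel)
  moreover have "dist a x \<le> dist a b + dist b x" by (rule dist_triangle)
  ultimately show "x \<in> outer_parallel A (\<delta> + \<epsilon>)"
    by (force simp: mem_outer_parallel)
qed

lemma outer_parallel_subset_add:
  "A \<subseteq> outer_parallel B \<epsilon> \<Longrightarrow> outer_parallel A \<delta> \<subseteq> outer_parallel B (\<delta> + \<epsilon>)"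
  using outer_parallel_mono[of A "outer_parallel B \<epsilon>" \<delta> \<delta>] outer_parallel_twice[of B \<epsilon> \<delta>]
  by (simp add: add.commute)

lemma compact_outer_parallel:
  fixes A :: "'a::euclidean_space set"
  shows "compact A \<Longrightarrow> compact (outer_parallel A \<delta>)"
  unfolding outer_parallel_def by (intro compact_sums) auto

text \<open>Compactness makes the distance to \<open>A\<close> attained, so a point within every
  \<open>d n\<close> is within the limit \<delta> of some point of \<open>A\<close>. The right
  continuity of the area functionals rests on this.\<close>

lemma INT_outer_parallel:
  fixes A :: "'a::euclidean_space set"
  assumes A: "compact A" and d: "\<And>n. \<delta> \<le> d n" "d \<longlonglongrightarrow> \<delta>"
  shows "(\<Inter>n::nat. outer_parallel A (d n)) = outer_parallel A \<delta>"
proof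
  show "outer_parallel A \<delta> \<subseteq> (\<Inter>n. outer_parallel A (d n))"
    using outer_parallel_mono[OF order_refl d(1)] by blast
  show "(\<Inter>n. outer_parallel A (d n)) \<subseteq> outer_parallel A \<delta>"
  proof
    fix x assume "x \<in> (\<Inter>n. outer_parallel A (d n))"
    then have "\<forall>n. \<exists>a\<in>A. dist a x \<le> d n" by (auto simp: mem_outer_parallel)
    then have ne: "A \<noteq> {}" and le: "\<And>n. infdist x A \<le> d n"
      by (auto, metis dist_commute infdist_le2)
    have "infdist x A \<le> \<delta>"
      by (rule LIMSEQ_le_const[OF d(2)]) (use le in auto)
    moreover obtain a where "a \<in> A" "infdist x A = dist x a"
      using infdist_attains_inf[OF compact_imp_closed[OF A] ne] by metis
    ultimately show "x \<in> outer_parallel A \<delta>"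
      by (auto simp: mem_outer_parallel dist_commute)
  qed
qed

lemma rot_image_outer_parallel: "rot \<theta> ` outer_parallel A \<delta> = outer_parallel (rot \<theta> ` A) \<delta>"
proof (intro equalityI subsetI)
  fix x assume "x \<in> outer_parallel (rot \<theta> ` A) \<delta>"
  then obtain a where "a \<in> A" "dist (rot \<theta> a) x \<le> \<delta>"
    by (auto simp: mem_outer_parallel)
  then have "dist a (rot (- \<theta>) x) \<le> \<delta>"
    by (metis dist_rot rot_minus_cancel(1))
  with \<open>a \<in> A\<close> have "rot \<theta> (rot (- \<theta>) x) \<in> rot \<theta> ` outer_parallel A \<delta>"
    by (intro imageI) (auto simp: mem_outer_parallel)
  then show "x \<in> rot \<theta> ` outer_parallel A \<delta>" by simp
qed (auto simp: mem_outer_parallel)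

text \<open>A point of \<open>A\<close> away from \<open>B\<close> would carry a small ball lying in
  a parallel set of \<open>A\<close> and missing that of \<open>B\<close>. The area of a single set
  cannot see null sets; the areas of all parallel sets can, and so measure equalities become set
  equalities.\<close>

lemma outer_parallel_null_diff_imp_subset:
  fixes A B :: "'a::euclidean_space set"
  assumes "compact A" "compact B"
    and null: "\<And>\<delta>. 0 < \<delta> \<Longrightarrow> measure lebesgue (outer_parallel A \<delta> - outer_parallel B \<delta>) = 0"
  shows "A \<subseteq> B"
proof (rule ccontr)
  assume "\<not> A \<subseteq> B"
  then obtain x where x: "x \<in> A" "x \<notin> B" by blast
  then obtain e where e: "0 < e" "\<And>b. b \<in> B \<Longrightarrow> e \<le> dist x b"
    using separate_point_closed[OF compact_imp_closed[OF \<open>compact B\<close>]] by blast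
  \<comment> \<open>With a third of the gap, the way from \<open>x\<close> over \<open>y\<close> to
    a point \<open>b\<close> would have length at most \<open>2 * e / 3\<close>, which is less than
    \<open>e\<close>.\<close>
  have "cball x (e / 3) \<subseteq> outer_parallel A (e / 3) - outer_parallel B (e / 3)"
  proof
    fix y assume y: "y \<in> cball x (e / 3)"
    have "\<not> dist b y \<le> e / 3" if "b \<in> B" for b
      using e(2)[OF that] y dist_triangle[of x b y] e(1) by (simp add: dist_commute)
    then show "y \<in> outer_parallel A (e / 3) - outer_parallel B (e / 3)"
      using y x by (auto simp: mem_outer_parallel)
  qed
  then have "measure lebesgue (cball x (e / 3)) \<le> measure lebesgue (outer_parallel A (e / 3) - outer_parallel B (e / 3))"
    by (rule measure_mono_fmeasurable)
      (simp_all add: fmeasurable.Diff lmeasurable_compact compact_outer_parallel assms)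
  moreover have "measure lebesgue (cball x (e / 3)) = measure lborel (cball x (e / 3))"
    by (simp add: measure_completion)
  ultimately show False
    using content_cball_pos[of "e / 3" x] null[of "e / 3"] e(1) by linarith
qed

section \<open>Slices\<close>

text \<open>Bridge between \<open>lborel\<close>, where integrals over slices are computed, and the
  real-valued Lebesgue measure.\<close>

lemma emeasure_bounded_borel:
  fixes A :: "'a::euclidean_space set"
  assumes "A \<in> sets borel" "bounded A"
  shows "emeasure lborel A = ennreal (measure lebesgue A)"
  using assms emeasure_bounded_finite[OF assms(2)]
  by (simp add: measure_completion emeasure_eq_ennreal_measure less_top)

text \<open>One-dimensional Brunn-Minkowski inequality for adding an interval: \<open>D\<close>
  contains a copy of \<open>C\<close> shifted left by \<open>w\<close> and, beyond the top of that
  copy, an interval of length \<open>2 * w\<close>.\<close>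

lemma measure_add_le_of_expansion:
  fixes C D :: "real set"
  assumes C: "compact C" "C \<noteq> {}" and D: "D \<in> lmeasurable" and "0 \<le> w"
    and sub: "\<And>c. c \<in> C \<Longrightarrow> {c - w..c + w} \<subseteq> D"
  shows "measure lebesgue C + 2 * w \<le> measure lebesgue D"
proof -
  obtain b where b: "b \<in> C" "\<And>c. c \<in> C \<Longrightarrow> c \<le> b"
    using compact_attains_sup[OF C] by blast
  \<comment> \<open>The interval is open at \<open>b - w\<close>, the maximum of the shifted copy,
    so that the two are disjoint.\<close>
  let ?L = "(\<lambda>x. x - w) ` C" and ?I = "{b - w<..b + w}"
  have L: "?L \<in> lmeasurable"
    by (simp add: measurable_translation_subtract lmeasurable_compact C)
  have I: "?I \<in> lmeasurable"
    by (rule bounded_set_imp_lmeasurable) (auto intro: bounded_subset[of "{b-w..b+w}"])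
  have "measure lebesgue ?I = 2 * w"
    using \<open>0 \<le> w\<close> by (simp add: measure_completion)
  moreover have "?L \<inter> ?I = {}"
    using b by force
  ultimately have "measure lebesgue C + 2 * w = measure lebesgue (?L \<union> ?I)"
    using L I by (simp add: measure_Un3 measure_translation_subtract)
  also have "\<dots> \<le> measure lebesgue D"
  proof (rule measure_mono_fmeasurable[OF _ _ D])
    show "?L \<union> ?I \<subseteq> D"
      using sub[OF b(1)] sub \<open>0 \<le> w\<close> by force
  qed (use L I in \<open>simp add: fmeasurableD\<close>)
  finally show ?thesis .
qed

section \<open>Horizontal slices, the chords in direction \<open>e\<^sub>1\<close>\<close>

definition slice :: "(real^2) set \<Rightarrow> real \<Rightarrow> real set" where
  "slice A s = {t. vector [t, s] \<in> A}"

lemma mem_slice: "t \<in> slice A s \<longleftrightarrow> vector [t, s] \<in> A"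
  by (simp add: slice_def)

lemma vector_components [simp]: "vector [x$1, x$2] = (x :: real^2)"
  by (simp add: vec2_eq_iff)

lemma slice_components: "x \<in> A \<longleftrightarrow> x$1 \<in> slice A (x$2)"
  by (simp add: mem_slice)

lemma slice_mono: "A \<subseteq> B \<Longrightarrow> slice A s \<subseteq> slice B s"
  by (auto simp: mem_slice)

lemma vector2_eq_sum:
  "(vector [t, s] :: real^2) = t *\<^sub>R vector [1, 0] + s *\<^sub>R vector [0, 1]"
  by (simp add: vec2_eq_iff)

lemma compact_slice:
  assumes "compact A"
  shows "compact (slice A s)"
proof -
  have eq: "slice A s = (\<lambda>x. x$1) ` A \<inter> (\<lambda>t. vector [t, s]) -` A"
    by (force simp: slice_def)
  have "continuous_on UNIV (\<lambda>t::real. vector [t, s] :: real^2)"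
    by (subst vector2_eq_sum) (intro continuous_intros)
  then have "closed ((\<lambda>t. vector [t, s]) -` A)"
    using assms by (intro closed_vimage) (auto intro: compact_imp_closed simp: continuous_on_eq_continuous_at)
  moreover have "compact ((\<lambda>x. x$1) ` A)"
    using assms by (intro compact_continuous_image continuous_intros)
  ultimately show ?thesis
    unfolding eq by (rule compact_Int_closed[rotated])
qed

abbreviation e\<^sub>1 :: "real^2" where
  "e\<^sub>1 \<equiv> vector [1, 0]"

lemma rot_e1: "rot \<theta> e\<^sub>1 = vector [cos \<theta>, sin \<theta>]"
  by (simp add: vec2_eq_iff)

text \<open>The chord through \<open>x\<close> can only be based at the projection of
  \<open>x\<close> to the second axis, so membership becomes a condition on one slice. Non-emptiness
  is a separate clause because a non-empty null slice still leaves its midpoint.\<close>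

lemma mem_steiner_e1:
  "x \<in> steiner_symmetral e\<^sub>1 A \<longleftrightarrow>
    slice A (x$2) \<noteq> {} \<and> \<bar>x$1\<bar> \<le> measure lebesgue (slice A (x$2)) / 2"
proof -
  have orth: "orthogonal e\<^sub>1 y \<longleftrightarrow> y$1 = 0" for y :: "real^2"
    by (simp add: orthogonal_def inner_vec_def sum_2)
  have line: "y + t *\<^sub>R e\<^sub>1 = vector [t, y$2]" if "y$1 = 0" for y :: "real^2" and t
    using that by (simp add: vec2_eq_iff)
  have hit: "line_through y e\<^sub>1 \<inter> A \<noteq> {} \<longleftrightarrow> slice A (y$2) \<noteq> {}" if "y$1 = 0" for y
    unfolding line_through_def slice_def line[OF that] by auto
  have chord: "chord_length e\<^sub>1 A y = measure lebesgue (slice A (y$2))" if "y$1 = 0" for y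
    unfolding chord_length_def slice_def line[OF that] ..
  have seg: "x \<in> closed_segment (y - (c / 2) *\<^sub>R e\<^sub>1) (y + (c / 2) *\<^sub>R e\<^sub>1) \<longleftrightarrow> x$2 = y$2 \<and> \<bar>x$1\<bar> \<le> c / 2"
    if "y$1 = 0" "0 \<le> c" for y :: "real^2" and c
  proof
    assume "x \<in> closed_segment (y - (c / 2) *\<^sub>R e\<^sub>1) (y + (c / 2) *\<^sub>R e\<^sub>1)"
    then obtain v where v: "0 \<le> v" "v \<le> 1"
      "x = (1 - v) *\<^sub>R (y - (c / 2) *\<^sub>R e\<^sub>1) + v *\<^sub>R (y + (c / 2) *\<^sub>R e\<^sub>1)"
      by (auto simp: in_segment)
    have "x$1 = (2 * v - 1) * (c / 2)" "x$2 = y$2"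
      unfolding v(3) using that by (simp_all add: field_simps)
    moreover have "\<bar>2 * v - 1\<bar> * (c / 2) \<le> 1 * (c / 2)"
      using v that by (intro mult_right_mono) auto
    moreover have "\<bar>(2 * v - 1) * (c / 2)\<bar> = \<bar>2 * v - 1\<bar> * (c / 2)"
      using that by (simp add: abs_mult)
    ultimately show "x$2 = y$2 \<and> \<bar>x$1\<bar> \<le> c / 2"
      by simp
  next
    assume x: "x$2 = y$2 \<and> \<bar>x$1\<bar> \<le> c / 2"
    \<comment> \<open>For \<open>c = 0\<close> the segment is a single point, and 0 is an arbitrary
      choice of parameter.\<close>
    define v where "v = (if c = 0 then 0 else x$1 / c + 1 / 2)"
    have "0 \<le> v" "v \<le> 1"
      using x that by (auto simp: v_def field_simps)
    moreover have "x = (1 - v) *\<^sub>R (y - (c / 2) *\<^sub>R e\<^sub>1) + v *\<^sub>R (y + (c / 2) *\<^sub>R e\<^sub>1)"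
      using x that by (cases "c = 0") (simp_all add: vec2_eq_iff v_def field_simps)
    ultimately show "x \<in> closed_segment (y - (c / 2) *\<^sub>R e\<^sub>1) (y + (c / 2) *\<^sub>R e\<^sub>1)"
      by (auto simp: in_segment)
  qed
  show ?thesis
  proof
    assume "x \<in> steiner_symmetral e\<^sub>1 A"
    then obtain y where y: "y$1 = 0" "line_through y e\<^sub>1 \<inter> A \<noteq> {}"
      and x: "x \<in> closed_segment (y - (chord_length e\<^sub>1 A y / 2) *\<^sub>R e\<^sub>1) (y + (chord_length e\<^sub>1 A y / 2) *\<^sub>R e\<^sub>1)"
      unfolding steiner_symmetral_def orth by blast
    then show "slice A (x$2) \<noteq> {} \<and> \<bar>x$1\<bar> \<le> measure lebesgue (slice A (x$2)) / 2"
      using hit[OF y(1)] chord[OF y(1)] seg[OF y(1), of "chord_length e\<^sub>1 A y"] by simp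
  next
    assume x: "slice A (x$2) \<noteq> {} \<and> \<bar>x$1\<bar> \<le> measure lebesgue (slice A (x$2)) / 2"
    define y :: "real^2" where "y = vector [0, x$2]"
    have y: "y$1 = 0" "y$2 = x$2" by (simp_all add: y_def)
    have "x \<in> closed_segment (y - (chord_length e\<^sub>1 A y / 2) *\<^sub>R e\<^sub>1) (y + (chord_length e\<^sub>1 A y / 2) *\<^sub>R e\<^sub>1)"
      using x y chord[OF y(1)] seg[OF y(1), of "chord_length e\<^sub>1 A y"] by simp
    moreover have "line_through y e\<^sub>1 \<inter> A \<noteq> {}"
      using x hit[OF y(1)] y(2) by simp
    ultimately show "x \<in> steiner_symmetral e\<^sub>1 A"
      using y(1) unfolding steiner_symmetral_def orth by blast
  qed
qed

lemma slice_steiner_e1: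
  "slice (steiner_symmetral e\<^sub>1 A) s = (if slice A s = {} then {}
     else {- (measure lebesgue (slice A s) / 2)..measure lebesgue (slice A s) / 2})"
  unfolding slice_def[of "steiner_symmetral e\<^sub>1 A"] mem_steiner_e1 by (auto simp: abs_le_iff)

lemma measure_slice_steiner_e1:
  "measure lebesgue (slice (steiner_symmetral e\<^sub>1 A) s) = measure lebesgue (slice A s)"
  by (simp add: slice_steiner_e1 measure_completion)

text \<open>Rotations preserve lines, chord lengths and orthogonality. This reduces every direction
  of symmetrization to the fixed axis \<open>e\<^sub>1\<close>.\<close>

lemma steiner_symmetral_rot:
  "steiner_symmetral (rot \<theta> u) (rot \<theta> ` A) = rot \<theta> ` steiner_symmetral u A"
proof -
  have line: "rot \<theta> y + t *\<^sub>R rot \<theta> u = rot \<theta> (y + t *\<^sub>R u)" for y t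
    by (simp add: linear_add[OF linear_rot] linear_scale[OF linear_rot])
  have hit: "line_through (rot \<theta> y) (rot \<theta> u) \<inter> rot \<theta> ` A \<noteq> {} \<longleftrightarrow> line_through y u \<inter> A \<noteq> {}" for y
  proof -
    have "line_through (rot \<theta> y) (rot \<theta> u) = rot \<theta> ` line_through y u"
      by (simp add: line_through_def line image_image)
    then show ?thesis by (simp add: image_Int[OF inj_rot, symmetric])
  qed
  have chord: "chord_length (rot \<theta> u) (rot \<theta> ` A) (rot \<theta> y) = chord_length u A y" for y
    by (simp add: chord_length_def line inj_image_mem_iff[OF inj_rot])
  have orth: "orthogonal (rot \<theta> u) (rot \<theta> y) \<longleftrightarrow> orthogonal u y" for y
    using orthogonal_transformation_rot by (simp add: orthogonal_def orthogonal_transformation_def)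
  let ?Y = "\<lambda>u A. {y. orthogonal u y \<and> line_through y u \<inter> A \<noteq> {}}"
  have Y: "?Y (rot \<theta> u) (rot \<theta> ` A) = rot \<theta> ` ?Y u A"
  proof (intro equalityI subsetI)
    fix y assume "y \<in> ?Y (rot \<theta> u) (rot \<theta> ` A)"
    then have "rot (- \<theta>) y \<in> ?Y u A"
      using orth[of "rot (- \<theta>) y"] hit[of "rot (- \<theta>) y"] by simp
    then have "rot \<theta> (rot (- \<theta>) y) \<in> rot \<theta> ` ?Y u A"
      by (rule imageI)
    then show "y \<in> rot \<theta> ` ?Y u A" by simp
  qed (use orth hit in auto)
  have seg: "closed_segment (rot \<theta> y - c *\<^sub>R rot \<theta> u) (rot \<theta> y + c *\<^sub>R rot \<theta> u)
    = rot \<theta> ` closed_segment (y - c *\<^sub>R u) (y + c *\<^sub>R u)" for y c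
    by (simp add: closed_segment_linear_image[OF linear_rot, symmetric] linear_add[OF linear_rot]
        linear_diff[OF linear_rot] linear_scale[OF linear_rot])
  show ?thesis
    unfolding steiner_symmetral_def Y by (simp add: chord seg image_UN)
qed

section \<open>Cavalieri's principle\<close>

text \<open>Lebesgue measure is determined by its values on boxes, whose preimages here are
  rectangles. Identifying the plane with the product space makes Fubini's theorem available.\<close>

lemma distr_lborel_vector2:
  "distr lborel borel (\<lambda>p::real \<times> real. vector [fst p, snd p] :: real^2) = lborel"
proof (rule lborel_eqI[symmetric])
  have [measurable]: "(\<lambda>p::real \<times> real. vector [fst p, snd p] :: real^2) \<in> borel_measurable borel"
    by (subst vector2_eq_sum) (intro borel_measurable_continuous_onI continuous_intros)
  fix l u :: "real^2" assume lu: "\<And>b. b \<in> Basis \<Longrightarrow> l \<bullet> b \<le> u \<bullet> b"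
  have lu': "l$1 \<le> u$1" "l$2 \<le> u$2"
    using lu[of "axis 1 1"] lu[of "axis 2 1"] by (simp_all add: cart_eq_inner_axis)
  have "emeasure (distr lborel borel (\<lambda>p::real \<times> real. vector [fst p, snd p] :: real^2)) (box l u)
    = emeasure lborel ((\<lambda>p::real \<times> real. vector [fst p, snd p] :: real^2) -` box l u)"
    by (subst emeasure_distr) auto
  also have "(\<lambda>p::real \<times> real. vector [fst p, snd p] :: real^2) -` box l u
    = {l$1<..<u$1} \<times> {l$2<..<u$2}"
    by (auto simp: mem_box_cart forall_2)
  also have "emeasure lborel \<dots> = ennreal ((u$1 - l$1) * (u$2 - l$2))"
    using lu' by (simp add: lborel_prod[symmetric] lborel.emeasure_pair_measure_Times ennreal_mult)
  also have "(u$1 - l$1) * (u$2 - l$2) = (\<Prod>b\<in>Basis. (u - l) \<bullet> b)"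
  proof -
    have B: "Basis = {axis 1 1, axis 2 1 :: real^2}"
      by (auto simp: Basis_vec_def UNIV_2)
    show ?thesis
      unfolding B by (simp add: axis_eq_axis cart_eq_inner_axis inner_diff_left)
  qed
  finally show "emeasure (distr lborel borel (\<lambda>p::real \<times> real. vector [fst p, snd p] :: real^2)) (box l u)
    = (\<Prod>b\<in>Basis. (u - l) \<bullet> b)" .
qed simp

text \<open>Pulled back to the product measure. Borel sets are the convenient class because all of
  their slices are Borel.\<close>

lemma
  assumes A: "A \<in> sets borel"
  shows borel_measurable_emeasure_slice: "(\<lambda>s. emeasure lborel (slice A s)) \<in> borel_measurable borel"
    and emeasure_eq_integral_slices: "emeasure lborel A = (\<integral>\<^sup>+s. emeasure lborel (slice A s) \<partial>lborel)"
proof -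
  let ?v = "\<lambda>p::real \<times> real. vector [fst p, snd p] :: real^2"
  have [measurable]: "?v \<in> borel_measurable borel"
    by (subst vector2_eq_sum) (intro borel_measurable_continuous_onI continuous_intros)
  have V: "?v -` A \<in> sets (lborel \<Otimes>\<^sub>M lborel)"
  proof -
    have "?v -` A \<in> sets borel"
      using measurable_sets[of ?v borel borel A] A by simp
    then show ?thesis
      by (metis lborel_prod sets_lborel)
  qed
  have sl: "(\<lambda>t. (t, s)) -` (?v -` A) = slice A s" for s
    by (auto simp: slice_def)
  show "(\<lambda>s. emeasure lborel (slice A s)) \<in> borel_measurable borel"
    using lborel_pair.measurable_emeasure_Pair2[OF V] by (simp add: sl)
  have "emeasure lborel A = emeasure (distr lborel borel ?v) A"
    by (simp add: distr_lborel_vector2)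
  also have "\<dots> = emeasure lborel (?v -` A)"
    using A by (subst emeasure_distr) auto
  also have "\<dots> = (\<integral>\<^sup>+s. emeasure lborel (slice A s) \<partial>lborel)"
    using lborel_pair.emeasure_pair_measure_alt2[OF V] by (simp add: sl lborel_prod)
  finally show "emeasure lborel A = (\<integral>\<^sup>+s. emeasure lborel (slice A s) \<partial>lborel)" .
qed

section \<open>Symmetrization along the first axis\<close>

text \<open>The slice of \<open>outer_parallel A \<delta>\<close> at height \<open>x$2\<close>
  contains the slice of \<open>A\<close> at height \<open>y$2\<close> widened by \<open>w\<close> on
  both sides, so it is longer by at least \<open>2 * w\<close>. Passing from \<open>y\<close> to
  \<open>x\<close> changes the first coordinate by at most \<open>w\<close>, so the centered segment
  has room for \<open>x\<close>.\<close>

lemma steiner_outer_parallel_subset: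
  assumes A: "compact A"
  shows "outer_parallel (steiner_symmetral e\<^sub>1 A) \<delta> \<subseteq> steiner_symmetral e\<^sub>1 (outer_parallel A \<delta>)"
proof
  fix x assume "x \<in> outer_parallel (steiner_symmetral e\<^sub>1 A) \<delta>"
  then obtain y where y: "y \<in> steiner_symmetral e\<^sub>1 A" and xy: "dist y x \<le> \<delta>"
    by (auto simp: mem_outer_parallel)
  have "(y$1 - x$1)\<^sup>2 + (y$2 - x$2)\<^sup>2 \<le> \<delta>\<^sup>2"
    using xy unfolding dist_vec2 by (rule sqrt_le_D)
  \<comment> \<open>Half the chord that a disc of radius \<delta> has at distance
    \<open>\<bar>y$2 - x$2\<bar>\<close> from its center.\<close>
  define w where "w = sqrt (\<delta>\<^sup>2 - (y$2 - x$2)\<^sup>2)"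
  have le: "(y$1 - x$1)\<^sup>2 \<le> \<delta>\<^sup>2 - (y$2 - x$2)\<^sup>2"
    using \<open>(y$1 - x$1)\<^sup>2 + (y$2 - x$2)\<^sup>2 \<le> \<delta>\<^sup>2\<close> by linarith
  then have nonneg: "0 \<le> \<delta>\<^sup>2 - (y$2 - x$2)\<^sup>2"
    using zero_le_power2 order_trans by blast
  have w: "0 \<le> w" "w\<^sup>2 = \<delta>\<^sup>2 - (y$2 - x$2)\<^sup>2" "\<bar>y$1 - x$1\<bar> \<le> w"
    unfolding w_def using nonneg real_sqrt_le_mono[OF le] by simp_all
  have ne: "slice A (y$2) \<noteq> {}" and y1: "\<bar>y$1\<bar> \<le> measure lebesgue (slice A (y$2)) / 2"
    using y by (simp_all add: mem_steiner_e1)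
  have "0 \<le> \<delta>"
    using xy zero_le_dist order_trans by blast
  have sub: "{c - w..c + w} \<subseteq> slice (outer_parallel A \<delta>) (x$2)" if "c \<in> slice A (y$2)" for c
  proof
    fix t assume "t \<in> {c - w..c + w}"
    then have "(c - t)\<^sup>2 \<le> w\<^sup>2"
      using w(1) by (simp flip: abs_le_square_iff) (simp add: abs_le_iff)
    then have "dist (vector [c, y$2]) (vector [t, x$2] :: real^2) \<le> \<delta>"
      using w(2) \<open>0 \<le> \<delta>\<close> by (auto simp: dist_vec2 intro!: real_le_lsqrt)
    then show "t \<in> slice (outer_parallel A \<delta>) (x$2)"
      using that by (auto simp: mem_slice mem_outer_parallel)
  qed
  have "measure lebesgue (slice A (y$2)) + 2 * w \<le> measure lebesgue (slice (outer_parallel A \<delta>) (x$2))"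
    using ne w(1) sub A
    by (intro measure_add_le_of_expansion lmeasurable_compact compact_slice compact_outer_parallel)
  moreover have "slice (outer_parallel A \<delta>) (x$2) \<noteq> {}"
    using ne sub w(1) by fastforce
  ultimately show "x \<in> steiner_symmetral e\<^sub>1 (outer_parallel A \<delta>)"
    using w(3) y1 by (simp add: mem_steiner_e1)
qed

section \<open>Area outside a centered ball\<close>

text \<open>The truncation at 0 covers the heights that miss the ball: there \<open>a = 0\<close>
  and the open interval is empty.\<close>

lemma slice_ball_0:
  assumes "0 \<le> r"
  obtains a where "0 \<le> a" "slice (ball 0 r) s = {-a<..<a}" "a\<^sup>2 = max 0 (r\<^sup>2 - s\<^sup>2)"
proof
  define a where "a = sqrt (max 0 (r\<^sup>2 - s\<^sup>2))"
  show a: "0 \<le> a" "a\<^sup>2 = max 0 (r\<^sup>2 - s\<^sup>2)"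
    by (simp_all add: a_def)
  have "t \<in> slice (ball 0 r) s \<longleftrightarrow> t\<^sup>2 + s\<^sup>2 < r\<^sup>2" for t
    using assms real_sqrt_less_iff[of "t\<^sup>2 + s\<^sup>2" "r\<^sup>2"] by (simp add: mem_slice norm_vec2)
  also have "t\<^sup>2 + s\<^sup>2 < r\<^sup>2 \<longleftrightarrow> t\<^sup>2 < a\<^sup>2" for t
    unfolding a(2) using zero_le_power2[of t] by linarith
  also have "t\<^sup>2 < a\<^sup>2 \<longleftrightarrow> t \<in> {-a<..<a}" for t
    using a(1) real_sqrt_less_iff[of "t\<^sup>2" "a\<^sup>2"] by (auto simp: abs_less_iff)
  finally show "slice (ball 0 r) s = {-a<..<a}"
    by blast
qed

lemma slice_Diff: "slice (A - B) s = slice A s - slice B s"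
  by (auto simp: slice_def)

lemma measure_centered_Icc_diff:
  fixes a c :: real
  assumes "0 \<le> a" "0 \<le> c"
  shows "measure lebesgue ({- (c / 2)..c / 2} - {-a<..<a}) = max 0 (c - 2 * a)"
proof (cases "a \<le> c / 2")
  case True
  have "measure lebesgue ({- (c / 2)..c / 2} - {-a<..<a})
    = measure lebesgue {- (c / 2)..c / 2} - measure lebesgue {-a<..<a}"
    by (rule measurable_measure_Diff) (use True in auto)
  then show ?thesis using True assms by (simp add: measure_completion)
next
  case False
  then have eq: "{- (c / 2)..c / 2} - {-a<..<a} = {}" by auto
  show ?thesis unfolding eq using False by simp
qed

text \<open>A slice of length \<open>c\<close> leaves at least \<open>c - 2 * a\<close> outside the
  chord of the ball, and the centered interval of that length leaves exactly the positive part of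
  this number.\<close>

lemma measure_slice_diff_ball_ge:
  assumes A: "compact A" and "0 \<le> r"
  shows "measure lebesgue (slice (steiner_symmetral e\<^sub>1 A - ball 0 r) s)
    \<le> measure lebesgue (slice (A - ball 0 r) s)"
proof (cases "slice A s = {}")
  case True
  then show ?thesis by (simp add: slice_Diff slice_steiner_e1)
next
  case False
  obtain a where a: "0 \<le> a" "slice (ball 0 r) s = {-a<..<a}"
    using slice_ball_0[OF \<open>0 \<le> r\<close>] by metis
  have C: "slice A s \<in> lmeasurable"
    by (simp add: lmeasurable_compact compact_slice A)
  have "measure lebesgue (slice A s) \<le> measure lebesgue ((slice A s - {-a<..<a}) \<union> {-a<..<a})"
    by (rule measure_mono_fmeasurable) (use C in \<open>auto simp: fmeasurable.Diff fmeasurableD\<close>)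
  also have "\<dots> \<le> measure lebesgue (slice A s - {-a<..<a}) + measure lebesgue {-a<..<a}"
    by (rule measure_Un_le) (use C in \<open>auto simp: fmeasurableD\<close>)
  finally have "measure lebesgue (slice A s) - 2 * a \<le> measure lebesgue (slice A s - {-a<..<a})"
    using a(1) by (simp add: measure_completion)
  then show ?thesis
    using False a measure_centered_Icc_diff[OF a(1), of "measure lebesgue (slice A s)"]
    by (simp add: slice_Diff slice_steiner_e1)
qed

section \<open>Boundedness, compactness and area of the symmetral\<close>

lemma steiner_subset_cball:
  assumes A: "A \<subseteq> cball 0 r"
  shows "steiner_symmetral e\<^sub>1 A \<subseteq> cball 0 r"
proof
  fix x assume x: "x \<in> steiner_symmetral e\<^sub>1 A"
  then obtain t where "t \<in> slice A (x$2)"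
    by (auto simp: mem_steiner_e1)
  have mem: "t\<^sup>2 + (x$2)\<^sup>2 \<le> r\<^sup>2 \<and> 0 \<le> r" if "t \<in> slice A (x$2)" for t
  proof -
    have "sqrt (t\<^sup>2 + (x$2)\<^sup>2) \<le> r"
      using that A by (auto simp: mem_slice norm_vec2)
    moreover have "0 \<le> sqrt (t\<^sup>2 + (x$2)\<^sup>2)"
      by simp
    ultimately show ?thesis
      by (meson order_trans sqrt_le_D)
  qed
  define a where "a = sqrt (r\<^sup>2 - (x$2)\<^sup>2)"
  have a: "0 \<le> a" "a\<^sup>2 = r\<^sup>2 - (x$2)\<^sup>2"
  proof -
    have "0 \<le> r\<^sup>2 - (x$2)\<^sup>2"
      using mem[OF \<open>t \<in> slice A (x$2)\<close>] zero_le_power2[of t] by linarith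
    then show "0 \<le> a" "a\<^sup>2 = r\<^sup>2 - (x$2)\<^sup>2"
      by (simp_all add: a_def)
  qed
  have "slice A (x$2) \<subseteq> {-a..a}"
  proof
    fix t assume "t \<in> slice A (x$2)"
    then have "t\<^sup>2 \<le> a\<^sup>2" using mem a(2) by force
    then have "\<bar>t\<bar> \<le> a" using a(1) by (simp add: abs_le_square_iff[symmetric])
    then show "t \<in> {-a..a}" by auto
  qed
  have "measure lebesgue (slice A (x$2)) \<le> 2 * a"
  \<comment> \<open>A non-measurable slice has \<open>measure\<close> 0 by convention, which also
    respects the bound.\<close>
  proof (cases "slice A (x$2) \<in> sets lebesgue")
    case True
    have "measure lebesgue (slice A (x$2)) \<le> measure lebesgue {-a..a}"
      by (rule measure_mono_fmeasurable) (use True \<open>slice A (x$2) \<subseteq> {-a..a}\<close> in auto)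
    then show ?thesis using a(1) by (simp add: measure_completion)
  qed (use a(1) in \<open>simp add: measure_notin_sets\<close>)
  with x have "\<bar>x$1\<bar> \<le> a"
    by (simp add: mem_steiner_e1)
  then have "(x$1)\<^sup>2 \<le> a\<^sup>2"
    using a(1) by (simp flip: abs_le_square_iff)
  then have "(x$1)\<^sup>2 + (x$2)\<^sup>2 \<le> r\<^sup>2"
    using a(2) by linarith
  then show "x \<in> cball 0 r"
    using mem[OF \<open>t \<in> slice A (x$2)\<close>] by (auto simp: norm_vec2 intro: real_le_lsqrt)
qed

text \<open>The semicontinuity that stands in for continuity of symmetrization: along the decreasing
  compact slices the lengths converge from above, and nested non-empty compact slices have a common
  point.\<close>

lemma INT_steiner_outer_parallel:
  assumes A: "compact A"
  shows "(\<Inter>n::nat. steiner_symmetral e\<^sub>1 (outer_parallel A (1 / Suc n))) \<subseteq> steiner_symmetral e\<^sub>1 A"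
proof
  fix x assume "x \<in> (\<Inter>n::nat. steiner_symmetral e\<^sub>1 (outer_parallel A (1 / Suc n)))"
  then have x: "x \<in> steiner_symmetral e\<^sub>1 (outer_parallel A (1 / Suc n))" for n
    by blast
  define C where "C n = slice (outer_parallel A (1 / Suc n)) (x$2)" for n :: nat
  have C: "C n \<noteq> {}" "\<bar>x$1\<bar> \<le> measure lebesgue (C n) / 2" "compact (C n)" for n
    using x[of n] by (auto simp: C_def mem_steiner_e1 compact_slice compact_outer_parallel A)
  have anti: "C n \<subseteq> C m" if "m \<le> n" for m n
    unfolding C_def using that by (intro slice_mono outer_parallel_mono) (simp_all add: field_simps)
  have INT: "(\<Inter>n. C n) = slice A (x$2)"
  proof -
    have "(\<Inter>n. outer_parallel A (1 / Suc n)) = outer_parallel A 0"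
      by (rule INT_outer_parallel[OF A]) (use LIMSEQ_Suc[OF lim_1_over_n[where 'a = real]] in simp_all)
    then show ?thesis
      by (auto simp: C_def slice_def)
  qed
  have "(\<lambda>n. measure lebesgue (C n)) \<longlonglongrightarrow> measure lebesgue (slice A (x$2))"
    unfolding INT[symmetric]
  proof (rule Lim_measure_decseq)
    show "emeasure lebesgue (C i) \<noteq> \<infinity>" for i
      using lmeasurable_compact[OF C(3)[of i]] by (auto simp: fmeasurable_def)
  qed (use anti lmeasurable_compact[OF C(3)] in \<open>auto simp: decseq_def fmeasurableD\<close>)
  then have "(\<lambda>n. measure lebesgue (C n) / 2) \<longlonglongrightarrow> measure lebesgue (slice A (x$2)) / 2"
    by (intro tendsto_intros) auto
  then have "\<bar>x$1\<bar> \<le> measure lebesgue (slice A (x$2)) / 2"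
    by (rule LIMSEQ_le_const) (use C(2) in auto)
  moreover have "slice A (x$2) \<noteq> {}"
    using compact_nest[of C, OF C(3) C(1) anti] INT by simp
  ultimately show "x \<in> steiner_symmetral e\<^sub>1 A"
    by (simp add: mem_steiner_e1)
qed

text \<open>A limit of points of the symmetral lies in each of its parallel sets, hence in the
  symmetral of each parallel set of \<open>A\<close>, and these have their intersection inside the
  symmetral of \<open>A\<close>.\<close>

lemma compact_steiner_e1:
  assumes A: "compact A"
  shows "compact (steiner_symmetral e\<^sub>1 A)"
proof -
  let ?S = "steiner_symmetral e\<^sub>1"
  obtain r where "\<forall>x\<in>A. norm x \<le> r"
    using compact_imp_bounded[OF A] by (auto simp: bounded_iff)
  then have "A \<subseteq> cball 0 r"
    by auto
  then have "bounded (?S A)"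
    by (intro bounded_subset[OF bounded_cball steiner_subset_cball])
  moreover have "closure (?S A) \<subseteq> ?S A"
  proof -
    have "closure (?S A) \<subseteq> ?S (outer_parallel A (1 / Suc n))" for n
    proof -
      have "closure (?S A) \<subseteq> outer_parallel (?S A) (1 / Suc n)"
      proof
        fix x assume "x \<in> closure (?S A)"
        then obtain y where "y \<in> ?S A" "dist y x < 1 / Suc n"
          by (meson closure_approachable zero_less_divide_1_iff of_nat_0_less_iff zero_less_Suc)
        then show "x \<in> outer_parallel (?S A) (1 / Suc n)"
          by (force simp: mem_outer_parallel)
      qed
      then show ?thesis
        using steiner_outer_parallel_subset[OF A] by blast
    qed
    then show ?thesis
      using INT_steiner_outer_parallel[OF A] by blast
  qed
  ultimately show ?thesis
    by (metis closure_subset_eq compact_eq_bounded_closed)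
qed

lemma steiner_e1_nonempty:
  assumes "A \<noteq> {}"
  shows "steiner_symmetral e\<^sub>1 A \<noteq> {}"
proof -
  obtain x where "x \<in> A" using assms by blast
  then have "slice A (x$2) \<noteq> {}"
    using slice_components by blast
  then have "vector [0, x$2] \<in> steiner_symmetral e\<^sub>1 A"
    by (simp add: mem_steiner_e1)
  then show ?thesis by blast
qed

lemma steiner_e1_reflect:
  assumes "x \<in> steiner_symmetral e\<^sub>1 A"
  shows "vector [- x$1, x$2] \<in> steiner_symmetral e\<^sub>1 A"
  using assms by (simp add: mem_steiner_e1)

lemma compact_diff_ball: "compact A \<Longrightarrow> compact (A - ball x r)"
  by (simp add: compact_diff)

lemma emeasure_compact:
  fixes A :: "'a::euclidean_space set"
  shows "compact A \<Longrightarrow> emeasure lborel A = ennreal (measure lebesgue A)"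
  by (simp add: emeasure_bounded_borel compact_imp_bounded borel_compact)

lemma measure_steiner_e1:
  assumes "compact A"
  shows "measure lebesgue (steiner_symmetral e\<^sub>1 A) = measure lebesgue A"
proof -
  have "emeasure lborel (slice (steiner_symmetral e\<^sub>1 A) s) = emeasure lborel (slice A s)" for s
    by (simp add: emeasure_compact compact_slice compact_steiner_e1 assms measure_slice_steiner_e1)
  then have "emeasure lborel (steiner_symmetral e\<^sub>1 A) = emeasure lborel A"
    using assms by (simp add: emeasure_eq_integral_slices borel_compact compact_steiner_e1)
  then show ?thesis
    using assms by (simp add: emeasure_compact compact_steiner_e1)
qed

lemma measure_steiner_diff_ball_le:
  assumes A: "compact A" and r: "0 \<le> r"
  shows "measure lebesgue (steiner_symmetral e\<^sub>1 A - ball 0 r) \<le> measure lebesgue (A - ball 0 r)"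
proof -
  let ?S = "steiner_symmetral e\<^sub>1 A"
  note c = compact_diff_ball[OF A, of 0 r] compact_diff_ball[OF compact_steiner_e1[OF A], of 0 r]
  have "emeasure lborel (?S - ball 0 r) \<le> emeasure lborel (A - ball 0 r)"
    unfolding emeasure_eq_integral_slices[OF borel_compact[OF c(1)]]
      emeasure_eq_integral_slices[OF borel_compact[OF c(2)]]
    by (intro nn_integral_mono)
      (simp add: emeasure_compact compact_slice c measure_slice_diff_ball_ge A r)
  then show ?thesis
    by (simp add: emeasure_compact c)
qed

text \<open>No slice gains length outside a centered ball when symmetrized, so the assumption forces
  equality on almost every slice. Letting the chord of the ball grow to the symmetrized slice from
  inside then leaves no length of \<open>A\<close> beyond it.\<close>

lemma steiner_rigidity:
  assumes A: "compact A"
    and eq: "\<And>r. 0 \<le> r \<Longrightarrow> measure lebesgue (A - ball 0 r) \<le> measure lebesgue (steiner_symmetral e\<^sub>1 A - ball 0 r)"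
  shows "measure lebesgue (A - steiner_symmetral e\<^sub>1 A) = 0"
proof -
  let ?S = "steiner_symmetral e\<^sub>1 A"
  let ?m = "\<lambda>B s. measure lebesgue (slice B s)"
  note S = compact_steiner_e1[OF A]
  have em: "emeasure lborel (slice B s) = ennreal (?m B s)" if "compact B" for B s
    by (simp add: emeasure_compact compact_slice that)
  have "AE s in lborel. ?m (A - ball 0 r) s \<le> ?m (?S - ball 0 r) s" if r: "0 \<le> r" for r
  proof -
    let ?f = "\<lambda>B s. emeasure lborel (slice B s)"
    note c = compact_diff_ball[OF A, of 0 r] compact_diff_ball[OF S, of 0 r]
    note b = borel_compact[OF c(1)] borel_compact[OF c(2)]
    \<comment> \<open>The reverse inequality holds at every height, so a failure on a non-null set
      of heights would make the two integrals differ strictly.\<close>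
    have "AE s in lborel. ?f (A - ball 0 r) s \<le> ?f (?S - ball 0 r) s"
    proof (rule ccontr)
      assume "\<not> (AE s in lborel. ?f (A - ball 0 r) s \<le> ?f (?S - ball 0 r) s)"
      moreover have "(\<integral>\<^sup>+s. ?f (?S - ball 0 r) s \<partial>lborel) \<noteq> \<infinity>"
        using emeasure_compact_finite[OF c(2)] emeasure_eq_integral_slices[OF b(2)] by simp
      moreover have "?f (?S - ball 0 r) s \<le> ?f (A - ball 0 r) s" for s
        unfolding em[OF c(1)] em[OF c(2)]
        by (rule ennreal_leI) (rule measure_slice_diff_ball_ge[OF A r])
      ultimately have "emeasure lborel (?S - ball 0 r) < emeasure lborel (A - ball 0 r)"
        unfolding emeasure_eq_integral_slices[OF b(1)] emeasure_eq_integral_slices[OF b(2)]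
        by (intro nn_integral_less) (auto intro: borel_measurable_emeasure_slice b)
      then show False
        using eq[OF r] unfolding emeasure_compact[OF c(1)] emeasure_compact[OF c(2)]
        by (meson ennreal_leI not_le)
    qed
    then show ?thesis
      by (simp add: em c)
  qed
  \<comment> \<open>Only countably many radii, so that one null set of heights serves for all of
    them.\<close>
  then have "AE s in lborel. \<forall>r\<in>{q\<in>\<rat>. 0 \<le> q}. ?m (A - ball 0 r) s \<le> ?m (?S - ball 0 r) s"
    by (subst AE_ball_countable) (auto intro: countable_subset[OF _ countable_rat])
  then have "AE s in lborel. emeasure lborel (slice (A - ?S) s) = 0"
  proof eventually_elim
    case (elim s)
    define c where "c = ?m A s"
    have C: "slice A s \<in> lmeasurable" "slice ?S s \<in> lmeasurable"
      by (simp_all add: lmeasurable_compact compact_slice A S)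
    have "?m (A - ?S) s \<le> 0"
    proof (cases "slice A s = {} \<or> c = 0")
      case True
      have "?m (A - ?S) s \<le> ?m A s"
        unfolding slice_Diff by (rule measure_mono_fmeasurable) (use C in \<open>auto simp: fmeasurableD\<close>)
      then show ?thesis using True by (auto simp: c_def)
    next
      case False
      then have "0 < c"
        by (simp add: c_def less_le)
      have I: "slice ?S s = {- (c / 2)..c / 2}"
        using False by (simp add: slice_steiner_e1 c_def)
      show ?thesis
      proof (rule field_le_epsilon)
        fix \<epsilon> :: real assume "0 < \<epsilon>"
        \<comment> \<open>The aim is a rational radius \<open>q\<close> whose chord at height
          \<open>s\<close> has half-length \<open>a\<close> strictly between \<open>t\<close> and
          \<open>c / 2\<close>; then \<open>c - 2 * a\<close> is less than \<epsilon>.\<close>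
        define t where "t = max 0 (c / 2 - \<epsilon> / 2)"
        have t: "0 \<le> t" "t < c / 2" "c - 2 * t \<le> \<epsilon>"
          using \<open>0 < c\<close> \<open>0 < \<epsilon>\<close> by (auto simp: t_def max_def)
        have "t\<^sup>2 < (c / 2)\<^sup>2"
          using t by (intro power_strict_mono) auto
        then have "sqrt (t\<^sup>2 + s\<^sup>2) < sqrt ((c / 2)\<^sup>2 + s\<^sup>2)"
          by simp
        then obtain q where q: "q \<in> \<rat>" "sqrt (t\<^sup>2 + s\<^sup>2) < q" "q < sqrt ((c / 2)\<^sup>2 + s\<^sup>2)"
          using Rats_dense_in_real by blast
        have "0 \<le> q"
          using q(2) by (rule order_trans[OF _ less_imp_le, rotated]) simp
        have q2: "t\<^sup>2 + s\<^sup>2 < q\<^sup>2" "q\<^sup>2 < (c / 2)\<^sup>2 + s\<^sup>2"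
          using q \<open>0 \<le> q\<close> real_sqrt_less_iff[of _ "q\<^sup>2"] real_sqrt_less_iff[of "q\<^sup>2"] by simp_all
        obtain a where a: "0 \<le> a" "slice (ball 0 q) s = {-a<..<a}" "a\<^sup>2 = max 0 (q\<^sup>2 - s\<^sup>2)"
          using slice_ball_0[OF \<open>0 \<le> q\<close>] by metis
        have "a\<^sup>2 < (c / 2)\<^sup>2" "t\<^sup>2 < a\<^sup>2"
          using q2 a(3) \<open>0 < c\<close> zero_le_power2[of t] by (auto simp: max_def)
        then have "a < c / 2" "t < a"
          using a(1) \<open>0 < c\<close> power2_less_imp_less[of a "c / 2"] power2_less_imp_less[of t a] by simp_all
        have "?m (A - ?S) s \<le> ?m (A - ball 0 q) s"
          unfolding slice_Diff I a(2)
          by (rule measure_mono_fmeasurable) (use C \<open>a < c / 2\<close> in \<open>auto simp: fmeasurableD fmeasurable.Diff\<close>)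
        also have "\<dots> \<le> ?m (?S - ball 0 q) s"
          using elim q(1) \<open>0 \<le> q\<close> by blast
        also have "\<dots> = c - 2 * a"
          using \<open>a < c / 2\<close> \<open>0 < c\<close> measure_centered_Icc_diff[OF a(1), of c] by (simp add: slice_Diff I a(2))
        finally show "?m (A - ?S) s \<le> 0 + \<epsilon>"
          using t \<open>t < a\<close> by linarith
      qed
    qed
    moreover have "emeasure lborel (slice (A - ?S) s) = ennreal (?m (A - ?S) s)"
      unfolding slice_Diff
      by (intro emeasure_bounded_borel bounded_diff) (auto simp: borel_compact compact_slice A S compact_imp_bounded)
    ultimately show ?case
      by (simp add: ennreal_eq_0_iff)
  qed
  moreover have b: "A - ?S \<in> sets borel"
    by (simp add: borel_compact A S sets.Diff)
  ultimately have "emeasure lborel (A - ?S) = 0"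
    by (simp add: emeasure_eq_integral_slices borel_measurable_emeasure_slice nn_integral_0_iff_AE)
  then show ?thesis
    using b by (simp add: measure_completion measure_def)
qed

section \<open>Hausdorff limits\<close>

text \<open>A form without infimum: such inclusions can be chained and rotated directly. It is
  translated into \<open>hausdorff_distance\<close> only at the end.\<close>

definition hausdorff_limit :: "(nat \<Rightarrow> 'a::real_normed_vector set) \<Rightarrow> 'a set \<Rightarrow> bool" where
  "hausdorff_limit A L \<longleftrightarrow> (\<forall>\<epsilon>>0. \<forall>\<^sub>F k in sequentially.
     A k \<subseteq> outer_parallel L \<epsilon> \<and> L \<subseteq> outer_parallel (A k) \<epsilon>)"

lemma hausdorff_limitD:
  assumes "hausdorff_limit A L" "0 < \<epsilon>"
  shows "\<forall>\<^sub>F k in sequentially. A k \<subseteq> outer_parallel L \<epsilon> \<and> L \<subseteq> outer_parallel (A k) \<epsilon>"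
  using assms by (simp add: hausdorff_limit_def)

lemma infdist_le_imp_mem_outer_parallel:
  fixes A :: "'a::euclidean_space set"
  assumes "compact A" "A \<noteq> {}" "infdist x A \<le> \<epsilon>"
  shows "x \<in> outer_parallel A \<epsilon>"
proof -
  obtain a where "a \<in> A" "infdist x A = dist x a"
    using infdist_attains_inf[OF compact_imp_closed[OF assms(1)] assms(2)] by metis
  then show ?thesis
    using assms(3) by (auto simp: mem_outer_parallel dist_commute)
qed

text \<open>The distance functions of the sets are 1-Lipschitz and uniformly bounded on the ball, so
  Arzela-Ascoli gives a uniformly convergent subsequence. The limit set is the zero set of the limit
  function \<open>g\<close>.\<close>

theorem blaschke_selection:
  fixes A :: "nat \<Rightarrow> 'a::euclidean_space set"
  assumes A: "\<And>n. compact (A n)" "\<And>n. A n \<noteq> {}" "\<And>n. A n \<subseteq> cball 0 \<rho>"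
  obtains \<phi> L where "strict_mono \<phi>" "compact L" "L \<noteq> {}" "hausdorff_limit (\<lambda>k. A (\<phi> k)) L"
proof -
  define f where "f n x = infdist x (A n)" for n x
  have lip: "\<bar>f n x - f n y\<bar> \<le> dist x y" for n x y
    unfolding f_def by (rule infdist_triangle_abs)
  have bound: "norm (f n x) \<le> 2 * \<rho>" if "x \<in> cball 0 \<rho>" for n x
  proof -
    obtain a where a: "a \<in> A n" using A(2) by blast
    have "dist x a \<le> dist x 0 + dist 0 a" by (rule dist_triangle)
    moreover have "norm a \<le> \<rho>" using a A(3)[of n] by auto
    ultimately have "infdist x (A n) \<le> 2 * \<rho>"
      using infdist_le[OF a, of x] that by simp
    then show ?thesis by (simp add: f_def infdist_nonneg)
  qed
  obtain g \<phi> where g: "continuous_on (cball 0 \<rho>) g" and \<phi>: "strict_mono (\<phi> :: nat \<Rightarrow> nat)"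
    and conv: "\<And>e. 0 < e \<Longrightarrow> \<exists>N. \<forall>n x. n \<ge> N \<and> x \<in> cball 0 \<rho> \<longrightarrow> norm (f (\<phi> n) x - g x) < e"
  proof (rule Arzela_Ascoli[of "cball 0 \<rho>" f "2 * \<rho>"])
    fix x :: 'a and e :: real assume "0 < e"
    then show "\<exists>d>0. \<forall>n y. y \<in> cball 0 \<rho> \<and> norm (x - y) < d \<longrightarrow> norm (f n x - f n y) < e"
      using lip by (metis dist_norm le_less_trans real_norm_def)
  qed (use bound in auto)
  have limg: "(\<lambda>n. f (\<phi> n) x) \<longlonglongrightarrow> g x" if "x \<in> cball 0 \<rho>" for x
    using conv that unfolding LIMSEQ_iff by metis
  define L where "L = {x \<in> cball 0 \<rho>. g x = 0}"
  have "closed L"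
    unfolding L_def using g by (intro continuous_closed_preimage_constant) auto
  then have "compact L"
    using compact_Int_closed[OF compact_cball, of L 0 \<rho>] by (simp add: L_def Int_def conj_ac)
  \<comment> \<open>Points of \<open>A (\<phi> n)\<close> nearest to \<open>x\<close> accumulate at
    some \<open>l\<close> in the ball. There \<open>g\<close> vanishes, and \<open>dist x l\<close>
    is the limit \<open>g x\<close> of the distances.\<close>
  have near: "\<exists>a\<in>L. dist x a \<le> g x" if x: "x \<in> cball 0 \<rho>" for x
  proof -
    have "\<exists>a. a \<in> A (\<phi> n) \<and> f (\<phi> n) x = dist x a" for n
      using infdist_attains_inf[OF compact_imp_closed[OF A(1)] A(2)] unfolding f_def by metis
    then obtain a where a: "\<And>n. a n \<in> A (\<phi> n)" "\<And>n. f (\<phi> n) x = dist x (a n)"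
      by metis
    have "\<forall>n. a n \<in> cball 0 \<rho>"
      using a(1) A(3) by blast
    then obtain l r where l: "l \<in> cball 0 \<rho>" "strict_mono r" "(a \<circ> r) \<longlonglongrightarrow> l"
      using compact_cball[of 0 \<rho>] unfolding compact_def by metis
    have "f (\<phi> (r n)) l \<le> dist l (a (r n))" for n
      unfolding f_def using a(1) by (rule infdist_le)
    moreover have "(\<lambda>n. f (\<phi> (r n)) l) \<longlonglongrightarrow> g l"
      using LIMSEQ_subseq_LIMSEQ[OF limg[OF l(1)] l(2)] by (simp add: o_def)
    moreover have "(\<lambda>n. dist l (a (r n))) \<longlonglongrightarrow> dist l l"
      using l(3) by (intro tendsto_intros) (simp add: o_def)
    ultimately have "g l \<le> 0"
      using LIMSEQ_le[of _ "g l" _ "dist l l"] by auto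
    moreover have "0 \<le> g l"
      by (rule LIMSEQ_le_const[OF limg[OF l(1)]]) (simp add: f_def infdist_nonneg)
    ultimately have "l \<in> L"
      using l(1) by (simp add: L_def)
    have "(\<lambda>n. dist x (a (r n))) \<longlonglongrightarrow> g x"
      using LIMSEQ_subseq_LIMSEQ[OF limg[OF x] l(2)] by (simp add: o_def a(2))
    moreover have "(\<lambda>n. dist x (a (r n))) \<longlonglongrightarrow> dist x l"
      using l(3) by (intro tendsto_intros) (simp add: o_def)
    ultimately have "dist x l = g x"
      using LIMSEQ_unique by blast
    with \<open>l \<in> L\<close> show ?thesis by (auto intro: bexI[of _ l])
  qed
  have "L \<noteq> {}"
  proof -
    obtain x where "x \<in> A 0" using A(2) by blast
    then have "x \<in> cball 0 \<rho>" using A(3) by blast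
    then show ?thesis using near by blast
  qed
  have "hausdorff_limit (\<lambda>k. A (\<phi> k)) L"
    unfolding hausdorff_limit_def
  proof (intro allI impI)
    fix \<epsilon> :: real assume "0 < \<epsilon>"
    then obtain N where N: "\<And>n x. n \<ge> N \<Longrightarrow> x \<in> cball 0 \<rho> \<Longrightarrow> \<bar>f (\<phi> n) x - g x\<bar> < \<epsilon>"
      using conv by (metis real_norm_def)
    have "A (\<phi> n) \<subseteq> outer_parallel L \<epsilon> \<and> L \<subseteq> outer_parallel (A (\<phi> n)) \<epsilon>" if "n \<ge> N" for n
    proof (intro conjI subsetI)
      fix x assume x: "x \<in> A (\<phi> n)"
      then have "x \<in> cball 0 \<rho>" using A(3) by blast
      moreover have "f (\<phi> n) x = 0" using x by (simp add: f_def)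
      ultimately have "g x < \<epsilon>" using N[OF that, of x] by linarith
      then show "x \<in> outer_parallel L \<epsilon>"
        using near[OF \<open>x \<in> cball 0 \<rho>\<close>] by (force simp: mem_outer_parallel dist_commute)
    next
      fix x assume "x \<in> L"
      then have "infdist x (A (\<phi> n)) \<le> \<epsilon>"
        using N[OF that, of x] by (simp add: L_def f_def)
      then show "x \<in> outer_parallel (A (\<phi> n)) \<epsilon>"
        by (rule infdist_le_imp_mem_outer_parallel[OF A(1,2)])
    qed
    then show "\<forall>\<^sub>F k in sequentially. A (\<phi> k) \<subseteq> outer_parallel L \<epsilon> \<and> L \<subseteq> outer_parallel (A (\<phi> k)) \<epsilon>"
      by (auto simp: eventually_sequentially)
  qed
  with \<phi> \<open>compact L\<close> \<open>L \<noteq> {}\<close> show thesis by (rule that)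
qed

section \<open>The Lyapunov functionals\<close>

text \<open>Removing the open ball keeps the set compact when \<open>A\<close> is. For
  \<open>r = 0\<close> nothing is removed, so the areas of the parallel sets are among the
  functionals.\<close>

definition excess :: "real \<Rightarrow> real \<Rightarrow> (real^2) set \<Rightarrow> real" where
  "excess \<delta> r A = measure lebesgue (outer_parallel A \<delta> - ball 0 r)"

lemma compact_excess_set: "compact A \<Longrightarrow> compact (outer_parallel A \<delta> - ball 0 r)"
  for A :: "(real^2) set"
  by (intro compact_diff_ball compact_outer_parallel)

lemma measure_compact_mono:
  fixes A B :: "'a::euclidean_space set"
  shows "A \<subseteq> B \<Longrightarrow> compact A \<Longrightarrow> compact B \<Longrightarrow> measure lebesgue A \<le> measure lebesgue B"
  by (intro measure_mono_fmeasurable lmeasurable_compact fmeasurableD)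

lemma excess_0 [simp]: "excess \<delta> 0 A = measure lebesgue (outer_parallel A \<delta>)"
  by (simp add: excess_def)

text \<open>Hausdorff closeness costs a shift of \<delta> by \<epsilon>, which right continuity
  removes afterwards.\<close>

lemma excess_mono:
  assumes "A \<subseteq> outer_parallel B \<epsilon>" "compact A" "compact B"
  shows "excess \<delta> r A \<le> excess (\<delta> + \<epsilon>) r B"
  unfolding excess_def
  by (intro measure_compact_mono compact_excess_set Diff_mono outer_parallel_subset_add assms order_refl)

lemma excess_rot: "compact A \<Longrightarrow> excess \<delta> r (rot \<theta> ` A) = excess \<delta> r A"
  using measure_rot_image[OF compact_excess_set, of A \<theta> \<delta> r]
  by (simp add: excess_def image_set_diff[OF inj_rot] rot_image_outer_parallel)

text \<open>Right continuity in \<delta>, in the form that absorbs arbitrarily small enlargements: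
  measure is continuous from above along the decreasing sets \<open>B n\<close>.\<close>

lemma excess_le_of_all_greater:
  assumes A: "compact A" and le: "\<And>\<epsilon>. 0 < \<epsilon> \<Longrightarrow> x \<le> excess (\<delta> + \<epsilon>) r A"
  shows "x \<le> excess \<delta> r A"
proof -
  define B where "B n = outer_parallel A (\<delta> + 1 / Suc n) - ball 0 r" for n :: nat
  have B: "B n \<in> lmeasurable" for n
    unfolding B_def by (intro lmeasurable_compact compact_excess_set A)
  have "(\<lambda>n. measure lebesgue (B n)) \<longlonglongrightarrow> measure lebesgue (\<Inter>n. B n)"
  proof (rule Lim_measure_decseq)
    show "decseq B"
      unfolding decseq_def B_def
      by (intro allI impI Diff_mono outer_parallel_mono) (simp_all add: field_simps)
    show "emeasure lebesgue (B i) \<noteq> \<infinity>" for i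
      using B[of i] by (auto simp: fmeasurable_def)
  qed (use B in \<open>auto simp: fmeasurableD\<close>)
  moreover have "(\<Inter>n. B n) = outer_parallel A \<delta> - ball 0 r"
  proof -
    have "(\<lambda>n. \<delta> + 1 / Suc n) \<longlonglongrightarrow> \<delta> + 0"
      by (intro tendsto_intros LIMSEQ_Suc[OF lim_1_over_n])
    then have "(\<Inter>n. outer_parallel A (\<delta> + 1 / Suc n)) = outer_parallel A \<delta>"
      by (intro INT_outer_parallel[OF A]) simp_all
    then show ?thesis by (auto simp: B_def)
  qed
  ultimately have "(\<lambda>n. measure lebesgue (B n)) \<longlonglongrightarrow> excess \<delta> r A"
    by (simp add: excess_def)
  then show ?thesis
    by (rule LIMSEQ_le_const) (use le in \<open>auto simp: B_def excess_def\<close>)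
qed

lemma steiner_e1_mono:
  assumes "A \<subseteq> B" "compact A" "compact B"
  shows "steiner_symmetral e\<^sub>1 A \<subseteq> steiner_symmetral e\<^sub>1 B"
proof
  fix x assume x: "x \<in> steiner_symmetral e\<^sub>1 A"
  have "measure lebesgue (slice A (x$2)) \<le> measure lebesgue (slice B (x$2))"
    using assms by (intro measure_compact_mono slice_mono compact_slice)
  then show "x \<in> steiner_symmetral e\<^sub>1 B"
    using x slice_mono[OF assms(1), of "x$2"] by (auto simp: mem_steiner_e1)
qed

text \<open>Two effects point the same way: symmetrizing before enlarging gives a smaller set than
  enlarging first, and symmetrization does not move area out of centered balls.\<close>

lemma excess_steiner:
  assumes A: "compact A" and "0 \<le> r"
  shows "excess \<delta> r (steiner_symmetral e\<^sub>1 A) \<le> excess \<delta> r A"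
proof -
  have "excess \<delta> r (steiner_symmetral e\<^sub>1 A)
    \<le> measure lebesgue (steiner_symmetral e\<^sub>1 (outer_parallel A \<delta>) - ball 0 r)"
    unfolding excess_def
    by (intro measure_compact_mono Diff_mono steiner_outer_parallel_subset compact_diff_ball
        compact_outer_parallel compact_steiner_e1 A order_refl)
  also have "\<dots> \<le> excess \<delta> r A"
    unfolding excess_def by (intro measure_steiner_diff_ball_le compact_outer_parallel assms)
  finally show ?thesis .
qed

section \<open>The orbit in the rotating frame\<close>

definition rotated_steiner :: "real \<Rightarrow> (real^2) set \<Rightarrow> (real^2) set" where
  "rotated_steiner \<alpha> A = steiner_symmetral e\<^sub>1 (rot (- \<alpha>) ` A)"

definition orbit :: "real \<Rightarrow> (real^2) set \<Rightarrow> nat \<Rightarrow> (real^2) set" where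
  "orbit \<alpha> K n = (rotated_steiner \<alpha> ^^ n) K"

lemma orbit_simps [simp]:
  "orbit \<alpha> K 0 = K" "orbit \<alpha> K (Suc n) = rotated_steiner \<alpha> (orbit \<alpha> K n)"
  by (simp_all add: orbit_def)

text \<open>In the coordinate frame rotating with the direction of symmetrization, the non-autonomous
  sequence of symmetrals is the orbit of a single map.\<close>

lemma successive_symmetrals_eq_orbit:
  assumes "\<And>m. m \<ge> 1 \<Longrightarrow> u m = vector [cos (real m * \<alpha>), sin (real m * \<alpha>)]"
  shows "successive_symmetrals u K m = rot (real m * \<alpha>) ` orbit \<alpha> K m"
proof (induction m)
  case 0
  then show ?case by simp
next
  case (Suc m)
  let ?\<theta> = "real (Suc m) * \<alpha>"
  have "rot (real m * \<alpha>) ` orbit \<alpha> K m = rot ?\<theta> ` rot (- \<alpha>) ` orbit \<alpha> K m"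
    by (simp add: algebra_simps flip: rot_image_add)
  moreover have "u (Suc m) = rot ?\<theta> e\<^sub>1"
    by (simp add: assms rot_e1)
  ultimately show ?case
    by (simp add: Suc.IH steiner_symmetral_rot rotated_steiner_def del: of_nat_Suc)
qed

lemma compact_orbit: "compact K \<Longrightarrow> compact (orbit \<alpha> K n)"
  by (induction n) (simp_all add: rotated_steiner_def compact_steiner_e1 compact_rot_image)

lemma orbit_nonempty: "K \<noteq> {} \<Longrightarrow> orbit \<alpha> K n \<noteq> {}"
  by (induction n) (simp_all add: rotated_steiner_def steiner_e1_nonempty)

lemma orbit_subset_cball:
  assumes "K \<subseteq> cball 0 \<rho>"
  shows "orbit \<alpha> K n \<subseteq> cball 0 \<rho>"
proof (induction n)
  case (Suc n)
  have "rot (- \<alpha>) ` orbit \<alpha> K n \<subseteq> cball 0 \<rho>"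
    using image_mono[OF Suc.IH, of "rot (- \<alpha>)"] by (simp only: rot_image_cball)
  then show ?case
    by (simp add: rotated_steiner_def steiner_subset_cball)
qed (use assms in simp)

lemma measure_orbit:
  assumes "compact K"
  shows "measure lebesgue (orbit \<alpha> K n) = measure lebesgue K"
  by (induction n)
    (simp_all add: rotated_steiner_def measure_steiner_e1 measure_rot_image compact_rot_image
      compact_orbit assms)

lemma excess_orbit_antimono:
  assumes "compact K" "0 \<le> r" "m \<le> n"
  shows "excess \<delta> r (orbit \<alpha> K n) \<le> excess \<delta> r (orbit \<alpha> K m)"
  using assms(3)
proof (induction n rule: dec_induct)
  case (step n)
  have "excess \<delta> r (orbit \<alpha> K (Suc n)) \<le> excess \<delta> r (rot (- \<alpha>) ` orbit \<alpha> K n)"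
    using assms by (simp add: rotated_steiner_def excess_steiner compact_rot_image compact_orbit)
  also have "\<dots> = excess \<delta> r (orbit \<alpha> K n)"
    by (simp add: excess_rot compact_orbit assms)
  finally show ?case using step.IH by simp
qed simp

section \<open>Limit points of the orbit\<close>

text \<open>The omega-limit set of the orbit under Hausdorff convergence.\<close>

definition limit_sets :: "real \<Rightarrow> (real^2) set \<Rightarrow> (real^2) set set" where
  "limit_sets \<alpha> K = {L. compact L \<and> L \<noteq> {} \<and>
     (\<exists>\<phi>. strict_mono \<phi> \<and> hausdorff_limit (\<lambda>k. orbit \<alpha> K (\<phi> k)) L)}"

lemma limit_setE:
  assumes "L \<in> limit_sets \<alpha> K" "0 < \<epsilon>"
  obtains n where "N \<le> n" "orbit \<alpha> K n \<subseteq> outer_parallel L \<epsilon>" "L \<subseteq> outer_parallel (orbit \<alpha> K n) \<epsilon>"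
proof -
  obtain \<phi> where \<phi>: "strict_mono \<phi>" "hausdorff_limit (\<lambda>k. orbit \<alpha> K (\<phi> k)) L"
    using assms(1) by (auto simp: limit_sets_def)
  have "\<forall>\<^sub>F k in sequentially. N \<le> k"
    by (rule eventually_ge_at_top)
  with hausdorff_limitD[OF \<phi>(2) assms(2)]
  have "\<forall>\<^sub>F k in sequentially. N \<le> k \<and> orbit \<alpha> K (\<phi> k) \<subseteq> outer_parallel L \<epsilon>
    \<and> L \<subseteq> outer_parallel (orbit \<alpha> K (\<phi> k)) \<epsilon>"
    by eventually_elim simp
  then obtain k where "N \<le> k" "orbit \<alpha> K (\<phi> k) \<subseteq> outer_parallel L \<epsilon>"
    "L \<subseteq> outer_parallel (orbit \<alpha> K (\<phi> k)) \<epsilon>"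
    by (auto dest: eventually_happens)
  then show thesis
    using that[of "\<phi> k"] seq_suble[OF \<phi>(1), of k] by simp
qed

text \<open>The orbit is close to \<open>M\<close> at some time \<open>n\<close> and close to
  \<open>L\<close> at a later time \<open>m\<close>, and the functional has not grown in between.
  Exchanging \<open>L\<close> and \<open>M\<close> gives equality.\<close>

lemma excess_limit_sets:
  assumes K: "compact K" and LM: "L \<in> limit_sets \<alpha> K" "M \<in> limit_sets \<alpha> K" and r: "0 \<le> r"
  shows "excess \<delta> r L \<le> excess \<delta> r M"
proof (rule excess_le_of_all_greater)
  show M: "compact M" using LM(2) by (simp add: limit_sets_def)
  have L: "compact L" using LM(1) by (simp add: limit_sets_def)
  fix \<epsilon> :: real assume "0 < \<epsilon>"
  then have \<epsilon>: "0 < \<epsilon> / 2" by simp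
  obtain n where n: "orbit \<alpha> K n \<subseteq> outer_parallel M (\<epsilon> / 2)"
    using limit_setE[OF LM(2) \<epsilon>, of 0] by metis
  obtain m where m: "n \<le> m" "L \<subseteq> outer_parallel (orbit \<alpha> K m) (\<epsilon> / 2)"
    using limit_setE[OF LM(1) \<epsilon>, of n] by metis
  have "excess \<delta> r L \<le> excess (\<delta> + \<epsilon> / 2) r (orbit \<alpha> K m)"
    by (intro excess_mono m L compact_orbit K)
  also have "\<dots> \<le> excess (\<delta> + \<epsilon> / 2) r (orbit \<alpha> K n)"
    by (intro excess_orbit_antimono K r m)
  also have "\<dots> \<le> excess (\<delta> + \<epsilon> / 2 + \<epsilon> / 2) r M"
    by (intro excess_mono n M compact_orbit K)
  finally show "excess \<delta> r L \<le> excess (\<delta> + \<epsilon>) r M" by (simp add: add.assoc)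
qed

text \<open>Area is only upper semicontinuous under Hausdorff convergence, which bounds the area of
  \<open>K\<close> by that of \<open>L\<close>. For the converse, the areas of the parallel sets of
  the orbit stay below those of \<open>K\<close>, and these shrink to the area of
  \<open>K\<close>.\<close>

lemma measure_limit_set:
  assumes K: "compact K" and L: "L \<in> limit_sets \<alpha> K"
  shows "measure lebesgue L = measure lebesgue K"
proof (rule antisym)
  have cL: "compact L" using L by (simp add: limit_sets_def)
  have "excess 0 0 L \<le> excess 0 0 K"
  proof (rule excess_le_of_all_greater[OF K])
    fix \<epsilon> :: real assume \<epsilon>: "0 < \<epsilon>"
    obtain n where "L \<subseteq> outer_parallel (orbit \<alpha> K n) \<epsilon>"
      using limit_setE[OF L \<epsilon>, of 0] by metis
    then have "excess 0 0 L \<le> excess (0 + \<epsilon>) 0 (orbit \<alpha> K n)"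
      by (intro excess_mono cL compact_orbit K)
    also have "\<dots> \<le> excess (0 + \<epsilon>) 0 (orbit \<alpha> K 0)"
      by (rule excess_orbit_antimono[OF K]) simp_all
    finally show "excess 0 0 L \<le> excess (0 + \<epsilon>) 0 K" by simp
  qed
  then show "measure lebesgue L \<le> measure lebesgue K" by simp
  have "excess 0 0 K \<le> excess 0 0 L"
  proof (rule excess_le_of_all_greater[OF cL])
    fix \<epsilon> :: real assume \<epsilon>: "0 < \<epsilon>"
    obtain n where "orbit \<alpha> K n \<subseteq> outer_parallel L \<epsilon>"
      using limit_setE[OF L \<epsilon>, of 0] by metis
    then have "excess 0 0 (orbit \<alpha> K n) \<le> excess (0 + \<epsilon>) 0 L"
      by (intro excess_mono cL compact_orbit K)
    then show "excess 0 0 K \<le> excess (0 + \<epsilon>) 0 L"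
      by (simp add: measure_orbit K)
  qed
  then show "measure lebesgue K \<le> measure lebesgue L" by simp
qed

section \<open>Limit points are balls\<close>

lemma compact_measure_diff:
  fixes A B :: "'a::euclidean_space set"
  assumes "compact A" "compact B"
  shows "measure lebesgue (A - B) = measure lebesgue A - measure lebesgue (A \<inter> B)"
proof -
  have "measure lebesgue (A - A \<inter> B) = measure lebesgue A - measure lebesgue (A \<inter> B)"
    by (intro measurable_measure_Diff lmeasurable_compact fmeasurableD compact_Int assms) simp
  then show ?thesis by (simp only: Diff_Int2 Diff_Int Diff_cancel Un_empty_left)
qed

text \<open>A limit \<open>M\<close> of the successors is at first only contained in the symmetral
  of \<open>P\<close>. As \<open>M\<close> and \<open>P\<close> have equal functionals, no area is
  lost between \<open>outer_parallel M \<delta>\<close> and the symmetral of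
  \<open>outer_parallel P \<delta>\<close>, so rigidity applies.\<close>

lemma limit_set_invariant:
  assumes K: "compact K" "K \<noteq> {}" and L: "L \<in> limit_sets \<alpha> K"
  defines "P \<equiv> rot (- \<alpha>) ` L"
  shows "P \<in> limit_sets \<alpha> K" and "steiner_symmetral e\<^sub>1 P = P"
proof -
  let ?S = "steiner_symmetral e\<^sub>1"
  obtain \<phi> where \<phi>: "strict_mono \<phi>" "hausdorff_limit (\<lambda>k. orbit \<alpha> K (\<phi> k)) L"
    and cL: "compact L"
    using L by (auto simp: limit_sets_def)
  have P: "compact P"
    unfolding P_def by (intro compact_rot_image cL)
  note SP = compact_steiner_e1[OF P]
  obtain \<rho> where "\<forall>x\<in>K. norm x \<le> \<rho>"
    using compact_imp_bounded[OF K(1)] by (auto simp: bounded_iff)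
  then have "K \<subseteq> cball 0 \<rho>" by auto
  \<comment> \<open>The successors along \<phi> need not converge; a further subsequence does, and
    its limit is again a limit point of the orbit.\<close>
  obtain \<psi> M where \<psi>: "strict_mono \<psi>" and M: "compact M" "M \<noteq> {}"
    and lim: "hausdorff_limit (\<lambda>k. orbit \<alpha> K (Suc (\<phi> (\<psi> k)))) M"
  proof (rule blaschke_selection[of "\<lambda>k. orbit \<alpha> K (Suc (\<phi> k))" \<rho>])
    show "orbit \<alpha> K (Suc (\<phi> n)) \<subseteq> cball 0 \<rho>" for n
      by (rule orbit_subset_cball) fact
  qed (use K compact_orbit orbit_nonempty in \<open>auto simp del: orbit_simps\<close>)
  have "strict_mono (\<lambda>k. Suc (\<phi> (\<psi> k)))"
    using \<phi>(1) \<psi> by (simp add: strict_mono_def)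
  with M lim have M_lim: "M \<in> limit_sets \<alpha> K"
    unfolding limit_sets_def by blast
  have M_sub: "M \<subseteq> ?S P"
  proof -
    have "M \<subseteq> ?S (outer_parallel P (1 / Suc n))" for n
    proof -
      \<comment> \<open>Half of the radius is spent on the approximation of the orbit by
        \<open>L\<close>, half on that of \<open>M\<close> by the successor.\<close>
      define \<epsilon> where "\<epsilon> = 1 / (2 * real (Suc n))"
      have \<epsilon>: "0 < \<epsilon>" "\<epsilon> + \<epsilon> = 1 / Suc n" by (simp_all add: \<epsilon>_def field_simps)
      have "\<forall>\<^sub>F k in sequentially. orbit \<alpha> K (\<phi> (\<psi> k)) \<subseteq> outer_parallel L \<epsilon>"
        using eventually_subseq[OF \<psi> hausdorff_limitD[OF \<phi>(2) \<epsilon>(1)]] by eventually_elim simp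
      with hausdorff_limitD[OF lim \<epsilon>(1)]
      have "\<forall>\<^sub>F k in sequentially. orbit \<alpha> K (\<phi> (\<psi> k)) \<subseteq> outer_parallel L \<epsilon>
        \<and> M \<subseteq> outer_parallel (orbit \<alpha> K (Suc (\<phi> (\<psi> k)))) \<epsilon>"
        by eventually_elim simp
      then obtain m where m: "orbit \<alpha> K m \<subseteq> outer_parallel L \<epsilon>"
        "M \<subseteq> outer_parallel (orbit \<alpha> K (Suc m)) \<epsilon>"
        by (auto dest: eventually_happens simp del: orbit_simps)
      have "rot (- \<alpha>) ` orbit \<alpha> K m \<subseteq> outer_parallel P \<epsilon>"
        unfolding P_def rot_image_outer_parallel[symmetric] by (intro image_mono m)
      then have "orbit \<alpha> K (Suc m) \<subseteq> ?S (outer_parallel P \<epsilon>)"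
        unfolding orbit_simps rotated_steiner_def
        by (intro steiner_e1_mono compact_rot_image compact_orbit compact_outer_parallel K P)
      then have "M \<subseteq> outer_parallel (?S (outer_parallel P \<epsilon>)) \<epsilon>"
        using m(2) outer_parallel_mono by blast
      also have "\<dots> \<subseteq> ?S (outer_parallel (outer_parallel P \<epsilon>) \<epsilon>)"
        by (intro steiner_outer_parallel_subset compact_outer_parallel P)
      also have "\<dots> \<subseteq> ?S (outer_parallel P (\<epsilon> + \<epsilon>))"
        by (intro steiner_e1_mono outer_parallel_twice compact_outer_parallel P)
      finally show ?thesis by (simp only: \<epsilon>)
    qed
    then show ?thesis
      using INT_steiner_outer_parallel[OF P] by blast
  qed
  have eq: "excess \<delta> r M = excess \<delta> r P" if "0 \<le> r" for \<delta> r
    using excess_limit_sets[OF K(1) L M_lim that] excess_limit_sets[OF K(1) M_lim L that] cL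
    by (simp add: P_def excess_rot order_antisym)
  have null: "measure lebesgue (outer_parallel P \<delta> - ?S (outer_parallel P \<delta>)) = 0"
    "measure lebesgue (?S (outer_parallel P \<delta>) - outer_parallel P \<delta>) = 0"
    "measure lebesgue (?S (outer_parallel P \<delta>) - outer_parallel M \<delta>) = 0"
    and sub: "outer_parallel M \<delta> \<subseteq> ?S (outer_parallel P \<delta>)"
    "outer_parallel (?S P) \<delta> \<subseteq> ?S (outer_parallel P \<delta>)" for \<delta>
  proof -
    let ?B = "outer_parallel P \<delta>"
    have B: "compact ?B" by (intro compact_outer_parallel P)
    note SB = compact_steiner_e1[OF B]
    have M\<delta>: "compact (outer_parallel M \<delta>)" by (intro compact_outer_parallel M)
    show sub2: "outer_parallel (?S P) \<delta> \<subseteq> ?S ?B"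
      by (rule steiner_outer_parallel_subset[OF P])
    then show sub1: "outer_parallel M \<delta> \<subseteq> ?S ?B"
      using outer_parallel_mono[OF M_sub order_refl] by blast
    \<comment> \<open>\<open>outer_parallel M \<delta>\<close> lies inside the symmetral and has the
      functionals of \<open>?B\<close>, so outside each ball the symmetral has at least the area of
      \<open>?B\<close>.\<close>
    show null1: "measure lebesgue (?B - ?S ?B) = 0"
    proof (rule steiner_rigidity[OF B])
      fix r :: real assume "0 \<le> r"
      have "excess \<delta> r M \<le> measure lebesgue (?S ?B - ball 0 r)"
        unfolding excess_def by (intro measure_compact_mono Diff_mono sub1 order_refl compact_diff_ball M\<delta> SB)
      then show "measure lebesgue (?B - ball 0 r) \<le> measure lebesgue (?S ?B - ball 0 r)"
        using eq[OF \<open>0 \<le> r\<close>, of \<delta>] by (simp add: excess_def)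
    qed
    have m: "measure lebesgue (?S ?B) = measure lebesgue ?B"
      by (rule measure_steiner_e1[OF B])
    show "measure lebesgue (?S ?B - ?B) = 0"
      using null1 m compact_measure_diff[OF B SB] compact_measure_diff[OF SB B] by (simp add: Int_commute)
    have "measure lebesgue (outer_parallel M \<delta>) = measure lebesgue ?B"
      using eq[of 0 \<delta>] by simp
    then show "measure lebesgue (?S ?B - outer_parallel M \<delta>) = 0"
      using m compact_measure_diff[OF SB M\<delta>] sub1 by (simp add: Int_absorb1)
  qed
  have null_mono: "measure lebesgue X = 0"
    if "X \<subseteq> Y" "measure lebesgue Y = 0" "X \<in> lmeasurable" "Y \<in> lmeasurable" for X Y :: "(real^2) set"
    using measure_mono_fmeasurable[OF that(1) fmeasurableD[OF that(3)] that(4)] that(2)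
    by (simp add: order_antisym)
  note meas = fmeasurable.Diff lmeasurable_compact compact_outer_parallel compact_steiner_e1 P SP M(1)
  \<comment> \<open>The parallel set of the symmetral of \<open>P\<close> lies in the symmetral of
    the parallel set, which is contained in \<open>outer_parallel M \<delta>\<close> up to a null
    set.\<close>
  have "?S P \<subseteq> M"
  proof (rule outer_parallel_null_diff_imp_subset[OF SP M(1)])
    show "measure lebesgue (outer_parallel (?S P) \<delta> - outer_parallel M \<delta>) = 0" for \<delta>
      by (rule null_mono[OF Diff_mono[OF sub(2) order_refl] null(3)]; intro meas)
  qed
  with M_sub have "?S P = M" by blast
  have "P \<subseteq> M"
  proof (rule outer_parallel_null_diff_imp_subset[OF P M(1)])
    fix \<delta> :: real
    let ?B = "outer_parallel P \<delta>"
    have "measure lebesgue ((?B - ?S ?B) \<union> (?S ?B - outer_parallel M \<delta>)) \<le> 0"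
      by (rule order_trans[OF measure_Un_le]) (simp_all only: null fmeasurableD meas add_0)
    then have "measure lebesgue ((?B - ?S ?B) \<union> (?S ?B - outer_parallel M \<delta>)) = 0"
      by (simp add: order_antisym)
    then show "measure lebesgue (?B - outer_parallel M \<delta>) = 0"
      by (rule null_mono[rotated]; (intro fmeasurable.Un meas)?) blast
  qed
  moreover have "M \<subseteq> P"
  proof (rule outer_parallel_null_diff_imp_subset[OF M(1) P])
    show "measure lebesgue (outer_parallel M \<delta> - outer_parallel P \<delta>) = 0" for \<delta>
      by (rule null_mono[OF Diff_mono[OF sub(1) order_refl] null(2)]; intro meas)
  qed
  ultimately have "P = M" by blast
  then show "P \<in> limit_sets \<alpha> K" "?S P = P"
    using M_lim \<open>?S P = M\<close> by simp_all
qed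

text \<open>Counted in full turns, \<open>2 * \<alpha>\<close> is the irrational number
  \<open>\<alpha> / pi\<close>, whose multiples are dense modulo 1. Closedness of \<open>P\<close>
  passes to the limit angle.\<close>

lemma rot_invariant_of_irrational:
  assumes P: "closed P" and inv: "\<And>x. x \<in> P \<Longrightarrow> rot (2 * \<alpha>) x \<in> P"
    and irr: "\<not> (\<exists>q\<in>\<rat>. \<alpha> = q * pi)" and x: "x \<in> P"
  shows "rot \<beta> x \<in> P"
proof -
  have multiple: "rot (2 * pi * (real n * (\<alpha> / pi))) x \<in> P" for n
  proof (induction n)
    case (Suc n)
    have "2 * pi * (real (Suc n) * (\<alpha> / pi)) = 2 * \<alpha> + 2 * pi * (real n * (\<alpha> / pi))"
      by (simp add: field_simps)
    then show ?case
      using inv[OF Suc.IH] by (simp only: rot_add)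
  qed (simp add: x)
  have irr': "\<alpha> / pi \<notin> \<rat>"
    using irr by (metis nonzero_eq_divide_eq pi_neq_zero)
  \<comment> \<open>Whole turns change nothing; they bring a multiple close to the target
    \<open>\<beta> / (2 * pi)\<close>.\<close>
  have shift: "rot (2 * pi * (t - of_int h)) x = rot (2 * pi * t) x" for t h
  proof -
    have "2 * pi * (t - of_int h) = 2 * pi * t - 2 * pi * of_int h" by (simp add: algebra_simps)
    moreover have "cos (2 * pi * t - 2 * pi * of_int h) = cos (2 * pi * t)"
      "sin (2 * pi * t - 2 * pi * of_int h) = sin (2 * pi * t)"
      by (simp_all only: cos_diff sin_diff cos_int_2pin sin_int_2pin)
    ultimately show ?thesis by (simp add: rot_def)
  qed
  have "\<exists>t. rot (2 * pi * t) x \<in> P \<and> \<bar>t - \<beta> / (2 * pi)\<bar> < 1 / Suc n" for n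
  proof -
    obtain h k where k: "k > 0" "\<bar>of_int k * (\<alpha> / pi) - of_int h - \<beta> / (2 * pi)\<bar> < 1 / Suc n"
      using sequence_of_fractional_parts_is_dense[OF irr', of "1 / Suc n" "\<beta> / (2 * pi)"]
      by (metis of_nat_0_less_iff zero_less_Suc zero_less_divide_1_iff)
    have nat: "real_of_int k = real (nat k)" using k(1) by simp
    have "rot (2 * pi * (of_int k * (\<alpha> / pi) - of_int h)) x \<in> P"
      unfolding shift nat by (rule multiple)
    with k(2) show ?thesis by blast
  qed
  then obtain t where t: "\<And>n. rot (2 * pi * t n) x \<in> P" "\<And>n. \<bar>t n - \<beta> / (2 * pi)\<bar> < 1 / Suc n"
    by metis
  have "(\<lambda>n. t n - \<beta> / (2 * pi)) \<longlonglongrightarrow> 0"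
    by (rule Lim_null_comparison[OF _ LIMSEQ_Suc[OF lim_1_over_n]])
      (use t(2) in \<open>auto intro!: always_eventually less_imp_le\<close>)
  then have "t \<longlonglongrightarrow> \<beta> / (2 * pi)"
    by (simp add: LIM_zero_iff)
  then have "(\<lambda>n. 2 * pi * t n) \<longlonglongrightarrow> 2 * pi * (\<beta> / (2 * pi))"
    by (intro tendsto_intros)
  then have *: "(\<lambda>n. 2 * pi * t n) \<longlonglongrightarrow> \<beta>" by simp
  have rot_eq: "rot \<theta> x = (cos \<theta> * x$1 - sin \<theta> * x$2) *\<^sub>R vector [1, 0] + (sin \<theta> * x$1 + cos \<theta> * x$2) *\<^sub>R vector [0, 1]" for \<theta>
    by (simp add: vec2_eq_iff)
  have "(\<lambda>n. rot (2 * pi * t n) x) \<longlonglongrightarrow> rot \<beta> x"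
    unfolding rot_eq by (intro tendsto_intros *)
  then show ?thesis
    by (rule closed_sequentially[OF P t(1)])
qed

lemma rot_to_axis:
  obtains \<theta> where "x = rot \<theta> (vector [norm x, 0])"
proof (cases "x = 0")
  case True
  then show thesis using that[of 0] by (simp add: vec2_eq_iff)
next
  case False
  then have "(norm x)\<^sup>2 \<noteq> 0" by simp
  have "(x$1 / norm x)\<^sup>2 + (x$2 / norm x)\<^sup>2 = ((x$1)\<^sup>2 + (x$2)\<^sup>2) / (norm x)\<^sup>2"
    by (simp add: power_divide add_divide_distrib)
  also have "(x$1)\<^sup>2 + (x$2)\<^sup>2 = (norm x)\<^sup>2"
    by (simp add: norm_vec2)
  finally have "(x$1 / norm x)\<^sup>2 + (x$2 / norm x)\<^sup>2 = 1"
    using \<open>(norm x)\<^sup>2 \<noteq> 0\<close> by simp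
  then obtain \<theta> where "x$1 / norm x = cos \<theta>" "x$2 / norm x = sin \<theta>"
    by (rule sincos_total_2pi)
  then have "x = rot \<theta> (vector [norm x, 0])"
    using False by (simp add: vec2_eq_iff flip: \<open>x$1 / norm x = cos \<theta>\<close> \<open>x$2 / norm x = sin \<theta>\<close>)
  then show thesis by (rule that)
qed

text \<open>Rotation invariance alone would allow annuli. Once a farthest point is turned onto the
  first axis, the fixed point property fills the segment from the origin to it, and rotations sweep
  this segment over the ball.\<close>

lemma steiner_fixed_rot_invariant_imp_cball:
  assumes P: "compact P" "P \<noteq> {}" and fixed: "steiner_symmetral e\<^sub>1 P = P"
    and inv: "\<And>\<beta> x. x \<in> P \<Longrightarrow> rot \<beta> x \<in> P"
  obtains \<rho> where "0 \<le> \<rho>" "P = cball 0 \<rho>"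
proof -
  obtain x where x: "x \<in> P" "\<And>y. y \<in> P \<Longrightarrow> norm y \<le> norm x"
    using continuous_attains_sup[OF P, of norm] by (auto intro: continuous_intros)
  obtain \<theta> where "x = rot \<theta> (vector [norm x, 0])"
    by (rule rot_to_axis)
  then have "rot (- \<theta>) x = vector [norm x, 0]"
    by (metis rot_minus_cancel(1))
  then have "vector [norm x, 0] \<in> P"
    using inv[OF x(1), of "- \<theta>"] by simp
  then have "vector [norm x, 0] \<in> steiner_symmetral e\<^sub>1 P"
    by (simp only: fixed)
  then have seg: "vector [s, 0] \<in> P" if "0 \<le> s" "s \<le> norm x" for s
    using that by (subst fixed[symmetric]) (simp add: mem_steiner_e1)
  have "cball 0 (norm x) \<subseteq> P"
  proof
    fix y :: "real^2" assume "y \<in> cball 0 (norm x)"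
    then have "vector [norm y, 0] \<in> P"
      by (intro seg) simp_all
    moreover obtain \<eta> where "y = rot \<eta> (vector [norm y, 0])"
      by (rule rot_to_axis)
    ultimately show "y \<in> P" using inv by metis
  qed
  moreover have "P \<subseteq> cball 0 (norm x)"
    using x(2) by auto
  ultimately show thesis
    using that[of "norm x"] by auto
qed

text \<open>\<open>P\<close> and \<open>Q\<close> are consecutive rotates of \<open>L\<close>, both
  fixed by symmetrization, hence symmetric in the second axis. Thus \<open>P\<close> is symmetric in
  two axes meeting at the angle \<alpha>, and two reflections compose to the rotation by
  \<open>2 * \<alpha>\<close>.\<close>

lemma limit_set_eq_ball:
  assumes irr: "\<not> (\<exists>q\<in>\<rat>. \<alpha> = q * pi)"
    and K: "compact K" "K \<noteq> {}" and L: "L \<in> limit_sets \<alpha> K"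
  shows "L = equimeasurable_ball K"
proof -
  define P Q where "P = rot (- \<alpha>) ` L" and "Q = rot (- \<alpha>) ` P"
  have P: "P \<in> limit_sets \<alpha> K" "steiner_symmetral e\<^sub>1 P = P"
    unfolding P_def by (rule limit_set_invariant[OF K L])+
  have Q: "steiner_symmetral e\<^sub>1 Q = Q"
    unfolding Q_def by (rule limit_set_invariant[OF K P(1)])
  have cP: "compact P" "P \<noteq> {}"
    using P(1) by (auto simp: limit_sets_def)
  have reflP: "vector [- y$1, y$2] \<in> P" if "y \<in> P" for y
    using that steiner_e1_reflect[of y P] by (simp only: P(2))
  have reflQ: "vector [- y$1, y$2] \<in> Q" if "y \<in> Q" for y
    using that steiner_e1_reflect[of y Q] by (simp only: Q)
  have "rot (2 * \<alpha>) y \<in> P" if y: "y \<in> P" for y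
  proof -
    define z :: "real^2" where "z = vector [- y$1, y$2]"
    have "z \<in> P" unfolding z_def by (rule reflP[OF y])
    define w where "w = rot (- \<alpha>) z"
    have "w \<in> Q" using \<open>z \<in> P\<close> by (auto simp: Q_def w_def)
    then have "vector [- w$1, w$2] \<in> Q" by (rule reflQ)
    then have "rot \<alpha> (vector [- w$1, w$2]) \<in> P"
      by (auto simp: Q_def)
    \<comment> \<open>The reflection conjugates the rotation by \<open>- \<alpha>\<close> into that
      by \<alpha>, so the two rotations add up instead of cancelling.\<close>
    also have "rot \<alpha> (vector [- w$1, w$2]) = rot (2 * \<alpha>) y"
      
    proof -
      have "rot (2 * \<alpha>) y = rot \<alpha> (rot \<alpha> y)"
        by (simp flip: rot_add)
      then show ?thesis
        by (simp add: w_def z_def vec2_eq_iff algebra_simps)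
    qed
    finally show ?thesis .
  qed
  then have "rot \<beta> y \<in> P" if "y \<in> P" for \<beta> y
    using rot_invariant_of_irrational[OF compact_imp_closed[OF cP(1)] _ irr that] by blast
  then obtain \<rho> where \<rho>: "0 \<le> \<rho>" "P = cball 0 \<rho>"
    using steiner_fixed_rot_invariant_imp_cball[OF cP P(2)] by blast
  have "L = rot \<alpha> ` P"
    by (simp add: P_def image_image)
  then have "L = cball 0 \<rho>"
    by (simp add: \<rho>(2))
  moreover have "(THE r. 0 \<le> r \<and> measure lebesgue (cball (0::real^2) r) = measure lebesgue K) = \<rho>"
    using \<rho>(1) measure_limit_set[OF K(1) L] \<open>L = cball 0 \<rho>\<close>
    by (intro the1_equality equimeasurable_ball_radius conjI) (simp_all only:)
  ultimately show ?thesis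
    by (simp add: equimeasurable_ball_def)
qed

section \<open>Convergence of the whole orbit\<close>

text \<open>Were infinitely many orbit sets far from the ball, selection would extract from them a
  limit point other than the ball.\<close>

lemma orbit_hausdorff_limit:
  assumes irr: "\<not> (\<exists>q\<in>\<rat>. \<alpha> = q * pi)" and K: "compact K" "K \<noteq> {}"
  shows "hausdorff_limit (orbit \<alpha> K) (equimeasurable_ball K)"
proof (rule ccontr)
  let ?B = "equimeasurable_ball K"
  let ?near = "\<lambda>\<epsilon> A. A \<subseteq> outer_parallel ?B \<epsilon> \<and> ?B \<subseteq> outer_parallel A \<epsilon>"
  assume "\<not> hausdorff_limit (orbit \<alpha> K) ?B"
  then obtain \<epsilon> where \<epsilon>: "0 < \<epsilon>" "\<not> (\<forall>\<^sub>F k in sequentially. ?near \<epsilon> (orbit \<alpha> K k))"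
    by (auto simp: hausdorff_limit_def)
  obtain r :: "nat \<Rightarrow> nat" where r: "strict_mono r" "\<And>n. \<not> ?near \<epsilon> (orbit \<alpha> K (r n))"
    using not_eventually_sequentiallyD[OF \<epsilon>(2)] by metis
  obtain \<rho> where "\<forall>x\<in>K. norm x \<le> \<rho>"
    using compact_imp_bounded[OF K(1)] by (auto simp: bounded_iff)
  then have \<rho>: "K \<subseteq> cball 0 \<rho>" by auto
  obtain \<phi> L where \<phi>: "strict_mono \<phi>" "compact L" "L \<noteq> {}"
    and lim: "hausdorff_limit (\<lambda>k. orbit \<alpha> K (r (\<phi> k))) L"
    using blaschke_selection[of "\<lambda>k. orbit \<alpha> K (r k)" \<rho>] compact_orbit orbit_nonempty
      orbit_subset_cball[OF \<rho>] K by metis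
  have "strict_mono (\<lambda>k. r (\<phi> k))"
    using r(1) \<phi>(1) by (simp add: strict_mono_def)
  then have "L \<in> limit_sets \<alpha> K"
    using \<phi> lim unfolding limit_sets_def by blast
  then have "L = ?B"
    by (rule limit_set_eq_ball[OF irr K])
  then have "\<forall>\<^sub>F k in sequentially. ?near \<epsilon> (orbit \<alpha> K (r (\<phi> k)))"
    using hausdorff_limitD[OF lim \<epsilon>(1)] by simp
  then show False
    using r(2) by (auto dest: eventually_happens)
qed

lemma hausdorff_limit_imp_converges_hausdorff:
  assumes "hausdorff_limit A L"
  shows "converges_hausdorff A L"
  unfolding converges_hausdorff_def LIMSEQ_iff
proof (intro allI impI)
  fix \<epsilon> :: real assume \<epsilon>: "0 < \<epsilon>"
  then have "\<forall>\<^sub>F k in sequentially. A k \<subseteq> outer_parallel L (\<epsilon> / 2) \<and> L \<subseteq> outer_parallel (A k) (\<epsilon> / 2)"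
    by (intro hausdorff_limitD assms) simp
  moreover have "norm (hausdorff_distance (A k) L - 0) < \<epsilon>"
    if "A k \<subseteq> outer_parallel L (\<epsilon> / 2) \<and> L \<subseteq> outer_parallel (A k) (\<epsilon> / 2)" for k
  proof -
    let ?D = "{\<delta>. 0 < \<delta> \<and> A k \<subseteq> outer_parallel L \<delta> \<and> L \<subseteq> outer_parallel (A k) \<delta>}"
    \<comment> \<open>This member bounds the infimum strictly below \<epsilon> and shows that it is
      taken over a non-empty set.\<close>
    have mem: "\<epsilon> / 2 \<in> ?D" using that \<epsilon> by simp
    have "Inf ?D \<le> \<epsilon> / 2"
      using mem by (rule cInf_lower) (auto intro!: bdd_belowI[of _ 0])
    moreover have "0 \<le> Inf ?D"
      using mem by (intro cInf_greatest) auto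
    ultimately show ?thesis
      using \<epsilon> by (simp add: hausdorff_distance_def)
  qed
  ultimately show "\<exists>N. \<forall>k\<ge>N. norm (hausdorff_distance (A k) L - 0) < \<epsilon>"
    unfolding eventually_sequentially by blast
qed

text \<open>Equal areas make both halves of the symmetric difference equally large, so it is enough
  to control \<open>A k - L\<close>. It lies in a thin shell around \<open>L\<close>, whose area
  tends to 0 by right continuity.\<close>

lemma hausdorff_limit_imp_converges_symmetric_difference:
  assumes lim: "hausdorff_limit A L" and A: "\<And>k. compact (A k)" and L: "compact L"
    and eq: "\<And>k. measure lebesgue (A k) = measure lebesgue L"
  shows "converges_symmetric_difference A L"
  unfolding converges_symmetric_difference_def LIMSEQ_iff
proof (intro allI impI)
  fix \<eta> :: real assume \<eta>: "0 < \<eta>"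
  \<comment> \<open>The shell is allowed the area \<open>\<eta> / 2\<close> because it is counted
    once for each half.\<close>
  obtain \<epsilon> where \<epsilon>: "0 < \<epsilon>" "excess (0 + \<epsilon>) 0 L < measure lebesgue L + \<eta> / 2"
  proof -
    have "\<not> (measure lebesgue L + \<eta> / 2 \<le> excess 0 0 L)"
      using \<eta> by simp
    then show thesis
      using excess_le_of_all_greater[OF L, of "measure lebesgue L + \<eta> / 2" 0 0] that
      by (meson not_le)
  qed
  have "norm (measure lebesgue (sym_diff (A k) L) - 0) < \<eta>"
    if "A k \<subseteq> outer_parallel L \<epsilon> \<and> L \<subseteq> outer_parallel (A k) \<epsilon>" for k
  proof -
    have "measure lebesgue (sym_diff (A k) L) \<le> measure lebesgue (A k - L) + measure lebesgue (L - A k)"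
      by (intro measure_Un_le fmeasurableD fmeasurable.Diff lmeasurable_compact A L)
    also have "\<dots> = 2 * measure lebesgue (A k - L)"
      using compact_measure_diff[OF A[of k] L] compact_measure_diff[OF L A[of k]] eq
      by (simp add: Int_commute)
    also have "measure lebesgue (A k - L) \<le> measure lebesgue (outer_parallel L \<epsilon> - L)"
      using that by (intro measure_mono_fmeasurable fmeasurableD fmeasurable.Diff lmeasurable_compact
          A L compact_outer_parallel) auto
    also have "\<dots> = measure lebesgue (outer_parallel L \<epsilon>) - measure lebesgue L"
      using compact_measure_diff[OF compact_outer_parallel[OF L, of \<epsilon>] L] subset_outer_parallel[of \<epsilon> L] \<epsilon>(1)
      by (simp add: Int_absorb1)
    also have "\<dots> < \<eta> / 2"
      using \<epsilon>(2) by simp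
    finally show ?thesis by simp
  qed
  then show "\<exists>N. \<forall>k\<ge>N. norm (measure lebesgue (sym_diff (A k) L) - 0) < \<eta>"
    using hausdorff_limitD[OF lim \<epsilon>(1)] unfolding eventually_sequentially by blast
qed

lemma rot_image_equimeasurable_ball [simp]:
  "rot \<theta> ` equimeasurable_ball K = equimeasurable_ball K"
  by (simp add: equimeasurable_ball_def)

lemma measure_equimeasurable_ball:
  "measure lebesgue (equimeasurable_ball K) = measure lebesgue K"
  unfolding equimeasurable_ball_def by (rule conjunct2[OF theI'[OF equimeasurable_ball_radius]])

theorem theorem5p1:
  fixes \<alpha> :: real and u :: "nat \<Rightarrow> real^2" and K :: "(real^2) set"
  assumes "\<not> (\<exists>q\<in>\<rat>. \<alpha> = q * pi)"
    and "\<And>m. m \<ge> 1 \<Longrightarrow> u m = vector [cos (real m * \<alpha>), sin (real m * \<alpha>)]"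
    and "compact K" and "K \<noteq> {}"
  shows "converges_hausdorff (successive_symmetrals u K) (equimeasurable_ball K)
       \<and> converges_symmetric_difference (successive_symmetrals u K) (equimeasurable_ball K)"
proof -
  let ?B = "equimeasurable_ball K"
  have eq: "successive_symmetrals u K m = rot (real m * \<alpha>) ` orbit \<alpha> K m" for m
    by (rule successive_symmetrals_eq_orbit[OF assms(2)])
  have "hausdorff_limit (successive_symmetrals u K) ?B"
    unfolding hausdorff_limit_def
  proof (intro allI impI)
    fix \<epsilon> :: real assume "0 < \<epsilon>"
    then have "\<forall>\<^sub>F m in sequentially. orbit \<alpha> K m \<subseteq> outer_parallel ?B \<epsilon> \<and> ?B \<subseteq> outer_parallel (orbit \<alpha> K m) \<epsilon>"
      by (intro hausdorff_limitD orbit_hausdorff_limit assms)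
    then show "\<forall>\<^sub>F m in sequentially. successive_symmetrals u K m \<subseteq> outer_parallel ?B \<epsilon>
      \<and> ?B \<subseteq> outer_parallel (successive_symmetrals u K m) \<epsilon>"
    proof eventually_elim
      case (elim m)
      \<comment> \<open>The ball is rotation invariant and parallel sets commute with rotations, so
        both inclusions carry over from the rotating frame.\<close>
      then show ?case
        using image_mono[of _ _ "rot (real m * \<alpha>)"] rot_image_outer_parallel
          rot_image_equimeasurable_ball unfolding eq by metis
    qed
  qed
  moreover have "measure lebesgue (successive_symmetrals u K m) = measure lebesgue ?B" for m
    by (simp add: eq measure_rot_image measure_orbit compact_orbit assms(3) measure_equimeasurable_ball)
  ultimately show ?thesis
    using hausdorff_limit_imp_converges_hausdorff hausdorff_limit_imp_converges_symmetric_difference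
    by (simp add: eq compact_rot_image compact_orbit assms(3) equimeasurable_ball_def)
qed

end
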